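(* Let $\omega$ be a normalized weight function with $\log(t)=o(\omega(t))$ as $t\to\infty$ and $\mu(\omega)>0$. Then for all $0<r<\mu(\omega)$ there exists a normalized weight function $\sigma$ with $\log(t)=o(\sigma(t))$ as $t\to\infty$ such that for each $0<\gamma<r$ the following holds: there exists a constant $k_0>0$ such that for every $x>0$ and every $h>0$ there is a linear and continuous map $$E^{\sigma,\omega}_h:\ \Lambda_{\widehat{S}^x,h}\to\mathcal{A}_{\widehat{W}^{8x},k_0h}(S_\gamma),\qquad\lambda\mapsto f_\lambda,$$ such that $\mathcal{B}(f_\lambda)=\lambda$ for every $\lambda\in\Lambda_{\widehat{S}^x,h}$. Here $\Sigma=\{S^x:x>0\}$, $\Omega=\{W^x:x>0\}$ are the weight matrices associated with $\sigma$ and $\omega$, $\widehat{S}^x:=(p!S^x_p)_{p\in\mathbb{N}}$, $\widehat{W}^x:=(p!W^x_p)_{p\in\mathbb{N}}$, $\widehat{\Sigma}:=\{\widehat{S}^x:x>0\}$, $\widehat{\Omega}:=\{\widehat{W}^x:x>0\}$. Thus $\mathcal{B}(\mathcal{A}_{\{\widehat{\Omega}\}}(S_\gamma))\supseteq\Lambda_{\{\widehat{\Sigma}\}}$. Moreover, $\sigma$ can be chosen minimal (up to a constant) among those normalized weight functions $\tau$ satisfying $\log(t)=o(\tau(t))$, $\omega(t)=O(\tau(t))$ as $t\to\infty$ and $(\tau,\omega)_{\gamma_r}$: $\sigma$ itself has these properties, and $\sigma(t)=O(\tau(t))$ as $t\to\infty$ for every such $\tau$.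
   Context: $\mathbb{N}=\{0,1,2,\dots\}$. A weight function is a continuous nondecreasing $\omega:[0,\infty)\to[0,\infty)$ with $\omega(0)=0$ and $\lim_{t\to\infty}\omega(t)=+\infty$; it is normalized if $\omega(t)=0$ for all $t\in[0,1]$. Order of quasianalyticity: $\mu(\omega):=\sup\left\{r>0:\int_1^\infty\frac{\omega(u)}{u^{1+1/r}}\,du<+\infty\right\}\in[0,+\infty]$ ($0$ if there is no such $r$). Condition $(\tau,\omega)_{\gamma_r}$ ($r>0$): there is $C>0$ with $\int_1^\infty\frac{\omega(tu)}{u^{1+1/r}}\,du\le C\tau(t)+C$ for all $t\ge0$. Associated weight matrix: for a normalized weight function $\omega$ with $\log(t)=o(\omega(t))$ put $\varphi_\omega(t):=\omega(e^t)$, $\varphi^*_\omega(x):=\sup\{xy-\varphi_\omega(y):y\ge0\}$ for $x\ge0$, and $W^l_j:=\exp\left(\frac1l\varphi^*_\omega(lj)\right)$ for $l>0$, $j\in\mathbb{N}$; the matrix $\{S^l\}$ is defined in the same way from $\sigma$. Let $\mathcal{R}$ be the Riemann surface of the logarithm and $S_\gamma:=\{z\in\mathcal{R}:|\arg(z)|<\gamma\pi/2\}$. For a sequence $M$ of positive reals, $h>0$ and a sector $S$, $\mathcal{A}_{M,h}(S)$ is the Banach space of holomorphic $f$ on $S$ with $\|f\|_{M,h}:=\sup_{z\in S,p\in\mathbb{N}}\frac{|f^{(p)}(z)|}{h^pM_p}<\infty$, and $\Lambda_{M,h}$ is the Banach space of complex sequences $a$ with $|a|_{M,h}:=\sup_{p\in\mathbb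 N}\frac{|a_p|}{h^pM_p}<\infty$. For a family $\mathcal{M}=\{M^x:x>0\}$ put $\mathcal{A}_{\{\mathcal{M}\}}(S):=\bigcup_{x>0}\bigcup_{h>0}\mathcal{A}_{M^x,h}(S)$, $\Lambda_{\{\mathcal{M}\}}:=\bigcup_{x>0}\bigcup_{h>0}\Lambda_{M^x,h}$. The Borel map is $\mathcal{B}(f):=(f^{(p)}(0))_{p\in\mathbb{N}}$ with $f^{(p)}(0):=\lim_{z\in S,\,z\to0}f^{(p)}(z)$. *)

theory Defs
  imports "HOL-Complex_Analysis.Complex_Analysis"
begin

definition weight_function :: "(real \<Rightarrow> real) \<Rightarrow> bool" where
  "weight_function \<omega> \<longleftrightarrow>
     continuous_on {0..} \<omega> \<and> mono_on {0..} \<omega> \<and> (\<forall>t\<ge>0. \<omega> t \<ge> 0) \<and> \<omega> 0 = 0 \<and>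
     filterlim \<omega> at_top at_top"

definition normalized :: "(real \<Rightarrow> real) \<Rightarrow> bool" where
  "normalized \<omega> \<longleftrightarrow> (\<forall>t\<in>{0..1}. \<omega> t = 0)"

(* In ennreal the supremum of the empty set is 0, as the convention for mu requires. *)
definition mu :: "(real \<Rightarrow> real) \<Rightarrow> ennreal" where
  "mu \<omega> = (SUP r\<in>{r::real. r > 0 \<and>
      (\<integral>\<^sup>+u\<in>{1..}. ennreal (\<omega> u / u powr (1 + 1 / r)) \<partial>lborel) < \<infinity>}. ennreal r)"

definition gamma_cond :: "real \<Rightarrow> (real \<Rightarrow> real) \<Rightarrow> (real \<Rightarrow> real) \<Rightarrow> bool" where
  "gamma_cond r \<tau> \<omega> \<longleftrightarrow> (\<exists>C>0. \<forall>t\<ge>0.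
     (\<integral>\<^sup>+u\<in>{1..}. ennreal (\<omega> (t * u) / u powr (1 + 1 / r)) \<partial>lborel) \<le> ennreal (C * \<tau> t + C))"

definition young_conj :: "(real \<Rightarrow> real) \<Rightarrow> real \<Rightarrow> real" where
  "young_conj \<phi> x = (SUP y\<in>{0..}. x * y - \<phi> y)"

definition weight_matrix :: "(real \<Rightarrow> real) \<Rightarrow> real \<Rightarrow> nat \<Rightarrow> real" where
  "weight_matrix \<omega> l j = exp (1 / l * young_conj (\<lambda>t. \<omega> (exp t)) (l * real j))"

definition hat :: "(nat \<Rightarrow> real) \<Rightarrow> nat \<Rightarrow> real" where
  "hat M p = fact p * M p"

(* The Riemann surface of the logarithm is represented by its global chart log: the complex
   number w stands for the point of modulus exp (Re w) and argument Im w, which lies over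
   exp w. Since log is biholomorphic, holomorphy on the surface is holomorphy in w. *)
definition sector :: "real \<Rightarrow> complex set" where
  "sector \<gamma> = {w. \<bar>Im w\<bar> < \<gamma> * pi / 2}"

(* d/dz in the logarithmic coordinate w, where z = exp w. *)
definition surface_deriv :: "(complex \<Rightarrow> complex) \<Rightarrow> complex \<Rightarrow> complex" where
  "surface_deriv f w = deriv f w / exp w"

lemma surface_deriv_quotient:
  assumes "f field_differentiable at w"
  shows "((\<lambda>v. (f v - f w) / (exp v - exp w)) \<longlongrightarrow> surface_deriv f w) (at w)"
proof -
  have "((\<lambda>v. (f v - f w) / (v - w)) \<longlongrightarrow> deriv f w) (at w)"
    using assms by (simp add: DERIV_deriv_iff_field_differentiable[symmetric] has_field_derivative_iff)
  moreover have "((\<lambda>v. (exp v - exp w) / (v - w)) \<longlongrightarrow> exp w) (at w)"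
    using DERIV_exp[of w] by (simp add: has_field_derivative_iff)
  ultimately have "((\<lambda>v. ((f v - f w) / (v - w)) / ((exp v - exp w) / (v - w)))
      \<longlongrightarrow> deriv f w / exp w) (at w)"
    by (rule tendsto_divide) simp
  moreover have "\<forall>\<^sub>F v in at w. ((f v - f w) / (v - w)) / ((exp v - exp w) / (v - w))
      = (f v - f w) / (exp v - exp w)"
    by (auto simp: eventually_at_filter)
  ultimately show ?thesis
    unfolding surface_deriv_def by (rule Lim_transform_eventually)
qed

abbreviation nth_deriv :: "nat \<Rightarrow> (complex \<Rightarrow> complex) \<Rightarrow> complex \<Rightarrow> complex" where
  "nth_deriv p f \<equiv> (surface_deriv ^^ p) f"

definition fun_ratios ::
    "(nat \<Rightarrow> real) \<Rightarrow> real \<Rightarrow> complex set \<Rightarrow> (complex \<Rightarrow> complex) \<Rightarrow> real set" where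
  "fun_ratios M h S f = {norm (nth_deriv p f z) / (h ^ p * M p) | z p. z \<in> S}"

definition fun_norm ::
    "(nat \<Rightarrow> real) \<Rightarrow> real \<Rightarrow> complex set \<Rightarrow> (complex \<Rightarrow> complex) \<Rightarrow> real" where
  "fun_norm M h S f = Sup (fun_ratios M h S f)"

(* A function on S is represented by its extension by 0, so that equality of elements of the
   space is equality on S. *)
definition fun_space :: "(nat \<Rightarrow> real) \<Rightarrow> real \<Rightarrow> complex set \<Rightarrow> (complex \<Rightarrow> complex) set" where
  "fun_space M h S =
     {f. f holomorphic_on S \<and> (\<forall>z. z \<notin> S \<longrightarrow> f z = 0) \<and> bdd_above (fun_ratios M h S f)}"

definition seq_ratios :: "(nat \<Rightarrow> real) \<Rightarrow> real \<Rightarrow> (nat \<Rightarrow> complex) \<Rightarrow> real set" where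
  "seq_ratios M h a = range (\<lambda>p. norm (a p) / (h ^ p * M p))"

definition seq_norm :: "(nat \<Rightarrow> real) \<Rightarrow> real \<Rightarrow> (nat \<Rightarrow> complex) \<Rightarrow> real" where
  "seq_norm M h a = Sup (seq_ratios M h a)"

definition seq_space :: "(nat \<Rightarrow> real) \<Rightarrow> real \<Rightarrow> (nat \<Rightarrow> complex) set" where
  "seq_space M h = {a. bdd_above (seq_ratios M h a)}"

definition fun_space_family ::
    "(real \<Rightarrow> nat \<Rightarrow> real) \<Rightarrow> complex set \<Rightarrow> (complex \<Rightarrow> complex) set" where
  "fun_space_family M S = (\<Union>x\<in>{0<..}. \<Union>h\<in>{0<..}. fun_space (M x) h S)"

definition seq_space_family :: "(real \<Rightarrow> nat \<Rightarrow> real) \<Rightarrow> (nat \<Rightarrow> complex) set" where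
  "seq_space_family M = (\<Union>x\<in>{0<..}. \<Union>h\<in>{0<..}. seq_space (M x) h)"

(* The vertex 0 corresponds to exp w = 0, that is, to Re w tending to minus infinity. *)
definition at_vertex :: "complex set \<Rightarrow> complex filter" where
  "at_vertex S = inf (filtercomap exp (nhds 0)) (principal S)"

definition borel_map :: "complex set \<Rightarrow> (complex \<Rightarrow> complex) \<Rightarrow> nat \<Rightarrow> complex" where
  "borel_map S f p = Lim (at_vertex S) (nth_deriv p f)"

definition linear_between ::
    "('a \<Rightarrow> complex) set \<Rightarrow> ('b \<Rightarrow> complex) set \<Rightarrow> (('a \<Rightarrow> complex) \<Rightarrow> 'b \<Rightarrow> complex) \<Rightarrow> bool" where
  "linear_between V W E \<longleftrightarrow>
     (\<forall>a\<in>V. E a \<in> W) \<and>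
     (\<forall>a\<in>V. \<forall>b\<in>V. E (\<lambda>i. a i + b i) = (\<lambda>z. E a z + E b z)) \<and>
     (\<forall>c. \<forall>a\<in>V. E (\<lambda>i. c * a i) = (\<lambda>z. c * E a z))"

definition continuous_between ::
    "('a \<Rightarrow> complex) set \<Rightarrow> (('a \<Rightarrow> complex) \<Rightarrow> real) \<Rightarrow> (('b \<Rightarrow> complex) \<Rightarrow> real) \<Rightarrow>
     (('a \<Rightarrow> complex) \<Rightarrow> 'b \<Rightarrow> complex) \<Rightarrow> bool" where
  "continuous_between V nV nW E \<longleftrightarrow>
     (\<forall>a\<in>V. \<forall>\<epsilon>>0. \<exists>\<delta>>0. \<forall>b\<in>V.
        nV (\<lambda>i. b i - a i) < \<delta> \<longrightarrow> nW (\<lambda>z. E b z - E a z) < \<epsilon>)"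

end

theory Submission
  imports Defs
begin

text \<open>
  Let \<open>\<kappa>(t)\<close> be the integral of \<open>\<omega>(t u) u powr (- 1 - 1 / r)\<close> over \<open>u \<ge> 1\<close>. It is finite because
  \<open>r < \<mu>(\<omega>)\<close>, and a weight \<open>\<tau>\<close> satisfies the condition of type \<open>\<gamma>\<^sub>r\<close> exactly if \<open>\<kappa> \<le> C \<tau> + C\<close> for some \<open>C\<close>. So
  a multiple of \<open>\<kappa>\<close>, made to vanish on \<open>[0, 1]\<close>, is the minimal such weight \<open>\<sigma>\<close>.

  The extension rests on one holomorphic function \<open>F\<close> on the sector of opening \<open>r\<close>, the integral of
  \<open>\<omega>(s) / (r s) \<zeta> / (1 + \<zeta>)\<^sup>2\<close> over \<open>s\<close>, where \<open>\<zeta> = (z / s) powr (1 / r)\<close>. On that sector \<open>\<zeta>\<close>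
  has positive real part, hence so has the integrand, and \<open>Re F(z) \<ge> c \<omega>(\<bar>z\<bar>)\<close> (lemma \<open>Re_F_ge\<close>);
  on the positive ray the kernel is at most \<open>min \<zeta> (1 / \<zeta>)\<close>, and \<open>F(t) \<le> B \<kappa>(t)\<close> (lemma
  \<open>Fr_le\<close>). For \<open>y = 4 c x\<close> the function \<open>z exp (- F(z) / y)\<close> is therefore a kernel
  whose moments \<open>m\<^sub>p\<close> are bounded below by \<open>S\<^sup>x\<^sub>p\<close> (lemma \<open>moment_lower_bound\<close>), while the absolute moments
  of its radial majorant are bounded above by \<open>W\<^sub>N\<close> of index \<open>8 x\<close> (lemma \<open>majorant_moment_le\<close>), in both
  cases up to constants and geometric factors.
  The multiple of \<open>\<kappa>\<close> in \<open>\<sigma>\<close> is chosen to make these indices match; it does not depend on \<open>\<gamma>\<close>.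

  Given \<open>\<lambda>\<close>, the series with coefficients \<open>\<lambda>\<^sub>p / (p! m\<^sub>p)\<close> converges near \<open>0\<close>, and its Laplace transform
  with this kernel, truncated at half the guaranteed radius of convergence, has the asymptotic expansion
  \<open>\<Sum> \<lambda>\<^sub>p z ^ p / p!\<close> with remainders controlled by \<open>W\<^sub>N\<close> of index \<open>8 x\<close> on the whole sector of opening
  \<open>r\<close> (lemma \<open>laplace_expansion\<close>). Cauchy's estimate on discs of radius proportional to \<open>\<bar>z\<bar>\<close> turns this
  into bounds and boundary values of the derivatives on the sector of opening \<open>\<gamma> < r\<close> (lemma
  \<open>asymptotic_expansion_derivatives\<close>).

  All functions are written in the chart \<open>w = log z\<close>, in which sectors are horizontal strips.
\<close>

section \<open>Holomorphic dependence of integrals on a parameter\<close>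

text \<open>The derivative under the integral sign is obtained by dominated convergence: Cauchy's
  estimate turns the majorant of the integrand into one of its difference quotients.\<close>

lemma holomorphic_on_integral:
  fixes f :: "complex \<Rightarrow> 'a \<Rightarrow> complex"
  assumes "open U"
    and holo: "\<And>t. (\<lambda>w. f w t) holomorphic_on U"
    and meas: "\<And>w. w \<in> U \<Longrightarrow> f w \<in> borel_measurable M"
    and g: "integrable M g"
    and bound: "\<And>w t. w \<in> U \<Longrightarrow> norm (f w t) \<le> g t"
  shows "(\<lambda>w. \<integral>t. f w t \<partial>M) holomorphic_on U"
proof -
  have int: "integrable M (f w)" if "w \<in> U" for w
    by (rule Bochner_Integration.integrable_bound[OF g meas[OF that]])
       (use bound[OF that] in \<open>auto intro!: AE_I2 intro: order_trans[OF _ abs_ge_self]\<close>)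
  have "\<exists>D. ((\<lambda>w. \<integral>t. f w t \<partial>M) has_field_derivative D) (at w0)" if w0: "w0 \<in> U" for w0
  proof -
    obtain e where "e > 0" and e: "cball w0 e \<subseteq> U"
      using \<open>open U\<close> w0 open_contains_cball by blast
    define d where "d = e / 2"
    have d: "d > 0" "e = 2 * d" using \<open>e > 0\<close> by (auto simp: d_def)
    have derb: "norm (deriv (\<lambda>w. f w t) u) \<le> g t / d" if u: "u \<in> ball w0 d" for u t
    proof -
      have "cball u d \<subseteq> cball w0 e"
        using u d by (intro subsetI, simp add: dist_commute) (metis dist_commute dist_triangle_le add_mono less_imp_le mult_2)
      then have sub: "cball u d \<subseteq> U" using e by auto
      have "norm ((deriv ^^ 1) (\<lambda>w. f w t) u) \<le> fact 1 * g t / d ^ 1"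
      proof (rule Cauchy_inequality)
        show "(\<lambda>w. f w t) holomorphic_on ball u d"
          using sub holo holomorphic_on_subset ball_subset_cball by blast
        show "continuous_on (cball u d) (\<lambda>w. f w t)"
          using sub holo holomorphic_on_subset holomorphic_on_imp_continuous_on by blast
        show "norm (f x t) \<le> g t" if "norm (u - x) = d" for x
          using that sub by (intro bound) (auto simp: dist_norm)
      qed (use d in auto)
      then show ?thesis by simp
    qed
    have quot: "norm ((f w t - f w0 t) / (w - w0)) \<le> g t / d" if w: "w \<in> ball w0 d" "w \<noteq> w0" for w t
    proof -
      have sub: "ball w0 d \<subseteq> U" using e d by auto
      have "norm (f w t - f w0 t) \<le> (g t / d) * norm (w - w0)"
      proof (rule field_differentiable_bound[where S = "ball w0 d"])
        show "((\<lambda>w. f w t) has_field_derivative deriv (\<lambda>w. f w t) z) (at z within ball w0 d)"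
          if "z \<in> ball w0 d" for z
          using holomorphic_derivI[OF holo \<open>open U\<close>] that sub
          by (meson has_field_derivative_at_within subsetD)
      qed (use w d derb in auto)
      then show ?thesis using w by (simp add: norm_divide divide_le_eq)
    qed
    have "((\<lambda>w. ((\<integral>t. f w t \<partial>M) - (\<integral>t. f w0 t \<partial>M)) / (w - w0))
        \<longlongrightarrow> (\<integral>t. deriv (\<lambda>w. f w t) w0 \<partial>M)) (at w0 within ball w0 d)"
      unfolding tendsto_at_iff_sequentially
    proof (intro allI impI)
      fix X assume X: "\<forall>i. X i \<in> ball w0 d - {w0}" "X \<longlonglongrightarrow> w0"
      have XU: "X i \<in> U" for i using X(1)[rule_format, of i] e d by auto
      have lim: "(\<lambda>i. (f (X i) t - f w0 t) / (X i - w0)) \<longlonglongrightarrow> deriv (\<lambda>w. f w t) w0" for t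
      proof -
        have "((\<lambda>w. (f w t - f w0 t) / (w - w0)) \<longlongrightarrow> deriv (\<lambda>w. f w t) w0) (at w0)"
          using holomorphic_derivI[OF holo \<open>open U\<close> w0] by (simp add: has_field_derivative_iff)
        then show ?thesis
          using X unfolding tendsto_at_iff_sequentially comp_def by auto
      qed
      have mq: "(\<lambda>t. (f (X i) t - f w0 t) / (X i - w0)) \<in> borel_measurable M" for i
        using meas[OF XU[of i]] meas[OF w0] by measurable
      have "(\<lambda>i. \<integral>t. (f (X i) t - f w0 t) / (X i - w0) \<partial>M) \<longlonglongrightarrow> (\<integral>t. deriv (\<lambda>w. f w t) w0 \<partial>M)"
      proof (rule integral_dominated_convergence[where w = "\<lambda>t. g t / d"])
        show "(\<lambda>t. deriv (\<lambda>w. f w t) w0) \<in> borel_measurable M"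
          by (rule borel_measurable_LIMSEQ_metric[OF mq lim])
        show "AE t in M. norm ((f (X i) t - f w0 t) / (X i - w0)) \<le> g t / d" for i
          using quot X(1) by (intro AE_I2) auto
      qed (use g mq lim in auto)
      moreover have "(\<integral>t. (f (X i) t - f w0 t) / (X i - w0) \<partial>M)
          = ((\<integral>t. f (X i) t \<partial>M) - (\<integral>t. f w0 t \<partial>M)) / (X i - w0)" for i
        using Bochner_Integration.integral_diff[OF int[OF XU[of i]] int[OF w0]] by simp
      ultimately show "((\<lambda>w. ((\<integral>t. f w t \<partial>M) - (\<integral>t. f w0 t \<partial>M)) / (w - w0)) \<circ> X)
          \<longlonglongrightarrow> (\<integral>t. deriv (\<lambda>w. f w t) w0 \<partial>M)" by (simp only: comp_def)
    qed
    then show ?thesis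
      using d by (auto simp: has_field_derivative_iff at_within_open[of w0 "ball w0 d"])
  qed
  then show ?thesis
    using \<open>open U\<close> by (auto simp: holomorphic_on_open)
qed

section \<open>Truncated Laplace transforms on a sector\<close>

lemma sector_iff: "w \<in> sector \<gamma> \<longleftrightarrow> \<bar>Im w\<bar> < \<gamma> * pi / 2"
  by (simp add: sector_def)

lemma sector_eq: "sector \<gamma> = {w. Im w < \<gamma> * pi / 2} \<inter> {w. Im w > - (\<gamma> * pi / 2)}"
  by (auto simp: sector_def)

lemma open_sector: "open (sector \<gamma>)"
  unfolding sector_eq by (intro open_Int open_halfspace_Im_lt open_halfspace_Im_gt)

lemma connected_sector: "connected (sector \<gamma>)"
  unfolding sector_eq
  by (intro convex_connected convex_Int convex_halfspace_Im_lt convex_halfspace_Im_gt)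

lemma integrable_exp_neg_abs: "integrable lborel (\<lambda>v::real. exp (- \<bar>v\<bar>))"
proof -
  have *: "integrable lborel (\<lambda>v::real. indicator {0..} v * exp (- v))"
  proof -
    have "(\<integral>\<^sup>+v. ennreal (exp (- v)) * indicator {0..} v \<partial>lborel) = ennreal (0 - (- exp (- 0::real)))"
    proof (rule nn_integral_FTC_atLeast)
      show "((\<lambda>v::real. - exp (- v)) \<longlongrightarrow> 0) at_top"
        using tendsto_minus[OF filterlim_compose[OF exp_at_bot filterlim_uminus_at_bot_at_top]] by simp
    qed (auto intro!: derivative_eq_intros)
    moreover have "ennreal (norm (indicator {0..} v * exp (- v))) = ennreal (exp (- v)) * indicator {0..} v"
      for v :: real by (auto simp: indicator_def)
    ultimately show ?thesis
      by (intro integrableI_bounded) (simp_all add: ennreal_mult_less_top)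
  qed
  have "integrable lborel (\<lambda>v::real. indicator {0..} (0 + (-1) * v) * exp (- (0 + (-1) * v)))"
    by (rule lborel_integrable_real_affine[OF *]) simp
  with * have "integrable lborel (\<lambda>v::real. indicator {0..} v * exp (- v)
      + indicator {0..} (0 + (-1) * v) * exp (- (0 + (-1) * v)))"
    by (rule Bochner_Integration.integrable_add)
  then show ?thesis
    by (rule Bochner_Integration.integrable_bound) (auto intro!: AE_I2 simp: indicator_def)
qed

lemma exp_linear_measurable [measurable]:
  "(\<lambda>v::real. exp (c * of_real v) :: complex) \<in> borel_measurable borel"
  by (intro borel_measurable_continuous_onI continuous_intros)

lemma holomorphic_on_sector_if_bounded_parts:
  assumes "\<And>B. f holomorphic_on (sector r \<inter> {w. \<bar>Re w\<bar> < B})"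
  shows "f holomorphic_on sector r"
proof -
  have op: "open (sector r \<inter> {w. \<bar>Re w\<bar> < B})" for B
    by (intro open_Int open_sector open_Collect_less continuous_intros)
  have "f field_differentiable at w" if "w \<in> sector r" for w
    using assms[of "\<bar>Re w\<bar> + 1"] holomorphic_on_imp_differentiable_at[OF _ op] that by auto
  then show ?thesis
    by (auto simp: holomorphic_on_def intro: field_differentiable_at_within)
qed

text \<open>A kernel on the sector of opening \<open>r\<close> in the logarithmic chart, with a majorant \<open>g\<close> that depends
  on the modulus \<open>exp (Re w)\<close> only. The decay condition says that \<open>g\<close> vanishes at least linearly
  at the vertex and faster than every power at infinity.\<close>

locale laplace_kernel =
  fixes K :: "complex \<Rightarrow> complex" and g :: "real \<Rightarrow> real" and r :: real
  assumes r: "0 < r"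
    and holo: "K holomorphic_on sector r"
    and g_meas [measurable]: "g \<in> borel_measurable borel"
    and bound: "\<And>w. w \<in> sector r \<Longrightarrow> norm (K w) \<le> g (Re w)"
    and decay: "\<And>n::nat. \<exists>D. \<forall>v. exp (real n * v) * g v \<le> D * exp (- \<bar>v\<bar>)"
begin

text \<open>The moments, written as \<open>\<integral> K(ln u) u ^ p du / u\<close> with \<open>u = exp v\<close>.\<close>

definition moment :: "nat \<Rightarrow> complex" where
  "moment p = (\<integral>v. K (of_real v) * exp (of_nat p * of_real v) \<partial>lborel)"

lemma shift_in_sector: "w \<in> sector r \<Longrightarrow> of_real v - w \<in> sector r"
  by (simp add: sector_iff)

lemma of_real_in_sector: "of_real v \<in> sector r"
  using r by (simp add: sector_iff)

lemma g_nonneg: "0 \<le> g v"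
  using order_trans[OF norm_ge_zero bound[OF of_real_in_sector[of v]]] by simp

lemma kernel_meas:
  assumes w: "w \<in> sector r"
  shows "(\<lambda>v::real. K (of_real v - w)) \<in> borel_measurable borel"
proof (rule borel_measurable_continuous_onI)
  show "continuous_on UNIV (\<lambda>v::real. K (of_real v - w))"
  proof (rule continuous_on_compose2[OF holomorphic_on_imp_continuous_on[OF holo]])
    show "continuous_on UNIV (\<lambda>v::real. of_real v - w)"
      by (intro continuous_intros)
  qed (use shift_in_sector[OF w] in blast)
qed

lemma g_moment_integrable: "integrable lborel (\<lambda>v. exp (real n * v) * g v)"
proof -
  obtain D where D: "\<And>v. exp (real n * v) * g v \<le> D * exp (- \<bar>v\<bar>)"
    using decay by blast
  show ?thesis
  proof (rule Bochner_Integration.integrable_bound[where f = "\<lambda>v. D * exp (- \<bar>v\<bar>)"])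
    show "AE v in lborel. norm (exp (real n * v) * g v) \<le> norm (D * exp (- \<bar>v\<bar>))"
    proof (intro AE_I2)
      fix v
      have "norm (exp (real n * v) * g v) = exp (real n * v) * g v"
        using g_nonneg[of v] by (simp add: abs_mult)
      also have "\<dots> \<le> norm (D * exp (- \<bar>v\<bar>))"
        using D[of v] by simp
      finally show "norm (exp (real n * v) * g v) \<le> norm (D * exp (- \<bar>v\<bar>))" .
    qed
  qed (use integrable_exp_neg_abs in auto)
qed

lemma shifted_moment_bound:
  assumes w: "w \<in> sector r"
  shows "norm (K (of_real v - w) * exp (of_nat p * of_real v))
      \<le> exp (real p * Re w) * (exp (real p * (v - Re w)) * g (v - Re w))"
proof -
  have "norm (K (of_real v - w)) * exp (real p * v) \<le> g (v - Re w) * exp (real p * v)"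
    using bound[OF shift_in_sector[OF w, of v]] by (intro mult_right_mono) auto
  also have "\<dots> = exp (real p * Re w) * (exp (real p * (v - Re w)) * g (v - Re w))"
    by (simp add: exp_add[symmetric] algebra_simps)
  finally show ?thesis by (simp add: norm_mult)
qed

lemma shifted_g_integrable:
  "integrable lborel (\<lambda>v. exp (real p * (v - x)) * g (v - x))"
  using lborel_integrable_real_affine[OF g_moment_integrable[of p], of 1 "-x"] by simp

lemma shifted_g_integral:
  "(\<integral>v. exp (real p * (v - x)) * g (v - x) \<partial>lborel) = (\<integral>v. exp (real p * v) * g v \<partial>lborel)"
  using lborel_integral_real_affine[of 1 "\<lambda>v. exp (real p * v) * g v" "-x"] by simp

lemma shifted_moment_integrable:
  assumes w: "w \<in> sector r"
  shows "integrable lborel (\<lambda>v. K (of_real v - w) * exp (of_nat p * of_real v))"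
proof (rule Bochner_Integration.integrable_bound
      [where f = "\<lambda>v. exp (real p * Re w) * (exp (real p * (v - Re w)) * g (v - Re w))"])
  show "(\<lambda>v. K (of_real v - w) * exp (of_nat p * of_real v)) \<in> borel_measurable lborel"
    using kernel_meas[OF w] by simp
  show "AE v in lborel. norm (K (of_real v - w) * exp (of_nat p * of_real v))
      \<le> norm (exp (real p * Re w) * (exp (real p * (v - Re w)) * g (v - Re w)))"
    using shifted_moment_bound[OF w] by (intro AE_I2) (metis abs_ge_self order_trans real_norm_def)
qed (use shifted_g_integrable in auto)

text \<open>A bound for the shifted kernel that is uniform as long as \<open>Re w\<close> stays bounded.\<close>

lemma shifted_kernel_uniform_bound:
  "\<exists>D. \<forall>w\<in>sector r. \<bar>Re w\<bar> < B \<longrightarrow>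
     (\<forall>v. norm (K (of_real v - w) * exp (of_nat p * of_real v)) \<le> D * exp (- \<bar>v\<bar>))"
proof -
  obtain D where D: "\<And>v. exp (real p * v) * g v \<le> D * exp (- \<bar>v\<bar>)"
    using decay by blast
  have D0: "D \<ge> 0" using D[of 0] g_nonneg[of 0] by simp
  show ?thesis
  proof (intro exI ballI impI allI)
    fix w v assume w: "w \<in> sector r" and B: "\<bar>Re w\<bar> < B"
    have "norm (K (of_real v - w) * exp (of_nat p * of_real v))
        \<le> exp (real p * Re w) * (exp (real p * (v - Re w)) * g (v - Re w))"
      by (rule shifted_moment_bound[OF w])
    also have "\<dots> \<le> exp (real p * B) * (D * exp (- \<bar>v - Re w\<bar>))"
      using B g_nonneg by (intro mult_mono D) (auto intro!: mult_left_mono)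
    also have "\<dots> \<le> exp (real p * B) * (D * exp (B - \<bar>v\<bar>))"
      using B D0 by (intro mult_left_mono) auto
    finally show "norm (K (of_real v - w) * exp (of_nat p * of_real v))
        \<le> (exp (real p * B) * D * exp B) * exp (- \<bar>v\<bar>)"
      by (simp add: exp_diff exp_minus field_simps)
  qed
qed

lemma kernel_shift_holomorphic: "(\<lambda>w. K (of_real v - w)) holomorphic_on sector r"
proof -
  have "(\<lambda>w. of_real v - w) holomorphic_on sector r"
    by (intro holomorphic_intros)
  from holomorphic_on_compose_gen[OF this holo] show ?thesis
    using shift_in_sector by (auto simp: comp_def)
qed

text \<open>The integral against \<open>exp (p v)\<close> scales like a monomial on the whole sector: after
  division by \<open>exp (p w)\<close> it is holomorphic in \<open>w\<close> and constant on the real line.\<close>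

lemma shifted_moment:
  assumes w: "w \<in> sector r"
  shows "(\<integral>v. K (of_real v - w) * exp (of_nat p * of_real v) \<partial>lborel) = moment p * exp (of_nat p * w)"
proof -
  define H where "H w = (\<integral>v. K (of_real v - w) * exp (of_nat p * of_real v) \<partial>lborel)" for w
  have holH: "H holomorphic_on sector r"
  proof (rule holomorphic_on_sector_if_bounded_parts)
    fix B
    obtain D where D: "\<And>w v. w \<in> sector r \<Longrightarrow> \<bar>Re w\<bar> < B \<Longrightarrow>
       norm (K (of_real v - w) * exp (of_nat p * of_real v)) \<le> D * exp (- \<bar>v\<bar>)"
      using shifted_kernel_uniform_bound by blast
    show "H holomorphic_on (sector r \<inter> {w. \<bar>Re w\<bar> < B})"
      unfolding H_def
    proof (rule holomorphic_on_integral[where g = "\<lambda>v. D * exp (- \<bar>v\<bar>)"])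
      show "open (sector r \<inter> {w. \<bar>Re w\<bar> < B})"
        by (intro open_Int open_sector open_Collect_less continuous_intros)
      show "(\<lambda>w. K (of_real v - w) * exp (of_nat p * of_real v)) holomorphic_on (sector r \<inter> {w. \<bar>Re w\<bar> < B})" for v
        by (intro holomorphic_intros holomorphic_on_subset[OF kernel_shift_holomorphic]) auto
      show "(\<lambda>v. K (of_real v - w) * exp (of_nat p * of_real v)) \<in> borel_measurable lborel"
        if "w \<in> sector r \<inter> {w. \<bar>Re w\<bar> < B}" for w
        using kernel_meas[of w] that by simp
    qed (use D integrable_exp_neg_abs in auto)
  qed
  have real: "H (of_real x) = moment p * exp (of_nat p * of_real x)" for x :: real
  proof -
    have "H (of_real x) = (\<integral>v. K (of_real (x + 1 * v) - of_real x) * exp (of_nat p * of_real (x + 1 * v)) \<partial>lborel)"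
      unfolding H_def by (subst lborel_integral_real_affine[of 1 _ x]) auto
    also have "\<dots> = (\<integral>v. K (of_real v) * exp (of_nat p * of_real v) * exp (of_nat p * of_real x) \<partial>lborel)"
      by (intro Bochner_Integration.integral_cong) (auto simp: exp_add[symmetric] algebra_simps)
    finally show ?thesis by (simp add: moment_def)
  qed
  have "H w - moment p * exp (of_nat p * w) = 0"
  proof (rule analytic_continuation[where f = "\<lambda>w. H w - moment p * exp (of_nat p * w)" and S = "sector r" and U = "range of_real" and \<xi> = 0])
    show "(\<lambda>w. H w - moment p * exp (of_nat p * w)) holomorphic_on sector r"
      by (intro holomorphic_intros holH)
    show "(0::complex) islimpt range of_real"
      unfolding islimpt_approachable
    proof (intro allI impI)
      fix e :: real assume "e > 0"
      then show "\<exists>x'\<in>range of_real. x' \<noteq> (0::complex) \<and> dist x' 0 < e"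
        by (intro bexI[where x = "of_real (e / 2)"]) (simp_all add: dist_norm rangeI del: of_real_divide)
    qed
  qed (use real w of_real_in_sector[of 0] of_real_in_sector in \<open>auto simp: open_sector connected_sector\<close>)
  then show ?thesis by (simp add: H_def)
qed


text \<open>Two bounds by \<open>2 * C * (2 * q * exp v) ^ N\<close>: for the tail of the series below the cut-off, where
  even \<open>q * exp v\<close> suffices as base, and for the partial sum above the cut-off.\<close>

lemma power_series_bound:
  assumes q: "q > 0" and v: "v \<le> - ln (2 * q)" and b: "\<And>p. norm (b p) \<le> C * q ^ p"
  shows "summable (\<lambda>p. b p * exp (of_nat p * of_real v) :: complex)"
    and "norm ((\<Sum>p. b p * exp (of_nat p * of_real v)) - (\<Sum>j<N. b j * exp (of_nat j * of_real v)))
      \<le> 2 * C * (q * exp v) ^ N"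
proof -
  define x where "x = q * exp v"
  have "exp v \<le> exp (- ln (2 * q))" using v by simp
  also have "\<dots> = 1 / (2 * q)" using q by (simp add: exp_minus field_simps)
  finally have x: "0 < x" "x \<le> 1 / 2" using q by (auto simp: x_def field_simps)
  have C: "C \<ge> 0" using order_trans[OF norm_ge_zero b[of 0]] by simp
  have nb: "norm (b p * exp (of_nat p * of_real v)) \<le> C * x ^ p" for p
  proof -
    have "norm (b p * exp (of_nat p * of_real v)) = norm (b p) * exp v ^ p"
      by (simp add: norm_mult exp_of_nat_mult norm_power)
    also have "\<dots> \<le> C * q ^ p * exp v ^ p"
      by (intro mult_right_mono b) auto
    finally show ?thesis by (simp add: x_def power_mult_distrib)
  qed
  have gs: "summable (\<lambda>p. C * x ^ (p + N))" for N
    using x by (intro summable_mult summable_ignore_initial_segment summable_geometric) auto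
  show sm: "summable (\<lambda>p. b p * exp (of_nat p * of_real v) :: complex)"
  proof (rule summable_comparison_test')
    show "summable (\<lambda>p. C * x ^ p)" using gs[of 0] by simp
  qed (rule nb)
  have "(\<Sum>p. b p * exp (of_nat p * of_real v)) - (\<Sum>j<N. b j * exp (of_nat j * of_real v))
      = (\<Sum>p. b (p + N) * exp (of_nat (p + N) * of_real v))"
    using suminf_split_initial_segment[OF sm, of N] by simp
  also have "norm \<dots> \<le> (\<Sum>p. C * x ^ (p + N))"
    by (rule norm_suminf_le[OF nb gs])
  also have "\<dots> = C * x ^ N * (\<Sum>p. x ^ p)"
    using x by (subst suminf_mult[symmetric]) (auto intro: summable_geometric simp: power_add mult_ac)
  also have "(\<Sum>p. x ^ p) = 1 / (1 - x)"
    using x by (intro suminf_geometric) auto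
  also have "C * x ^ N * (1 / (1 - x)) \<le> C * x ^ N * 2"
    using x C by (intro mult_left_mono) (auto simp: field_simps)
  finally show "norm ((\<Sum>p. b p * exp (of_nat p * of_real v)) - (\<Sum>j<N. b j * exp (of_nat j * of_real v)))
      \<le> 2 * C * (q * exp v) ^ N" by (simp add: x_def mult_ac)
qed

lemma polynomial_bound:
  assumes q: "q > 0" and v: "v > - ln (2 * q)" and b: "\<And>p. norm (b p) \<le> C * q ^ p"
  shows "norm (\<Sum>j<N. b j * exp (of_nat j * of_real v) :: complex) \<le> 2 * C * (2 * q * exp v) ^ N"
proof -
  define x where "x = 2 * q * exp v"
  have C: "C \<ge> 0" using order_trans[OF norm_ge_zero b[of 0]] by simp
  have "exp v > exp (- ln (2 * q))" using v by simp
  also have "exp (- ln (2 * q)) = 1 / (2 * q)" using q by (simp add: exp_minus field_simps)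
  finally have x: "x \<ge> 1" using q by (auto simp: x_def field_simps)
  have "norm (\<Sum>j<N. b j * exp (of_nat j * of_real v)) \<le> (\<Sum>j<N. (C * x ^ N) * (1 / 2) ^ j)"
  proof (rule sum_norm_le)
    fix j assume j: "j \<in> {..<N}"
    have "norm (b j * exp (of_nat j * of_real v)) = norm (b j) * exp v ^ j"
      by (simp add: norm_mult exp_of_nat_mult norm_power)
    also have "\<dots> \<le> C * q ^ j * exp v ^ j"
      by (intro mult_right_mono b) auto
    also have "\<dots> = C * x ^ j * (1 / 2) ^ j"
      by (simp add: x_def power_mult_distrib power_one_over)
    also have "\<dots> \<le> C * x ^ N * (1 / 2) ^ j"
      using x j C by (intro mult_right_mono mult_left_mono power_increasing) auto
    finally show "norm (b j * exp (of_nat j * of_real v)) \<le> (C * x ^ N) * (1 / 2) ^ j" .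
  qed
  also have "\<dots> = C * x ^ N * (\<Sum>j<N. (1 / 2) ^ j)" by (simp add: sum_distrib_left)
  also have "\<dots> \<le> C * x ^ N * 2"
  proof (rule mult_left_mono)
    show "(\<Sum>j<N. (1 / 2) ^ j) \<le> (2::real)"
      by (subst sum_gp_strict) (auto simp: field_simps)
  qed (use C x in auto)
  finally show ?thesis by (simp add: x_def mult_ac)
qed

text \<open>The power series with coefficients \<open>b\<close> at the point \<open>exp v\<close>, cut off at \<open>exp v = 1 / (2 * q)\<close>,
  which is half the radius of convergence that the bound \<open>\<bar>b p\<bar> \<le> C * q ^ p\<close> guarantees.\<close>

definition series :: "real \<Rightarrow> (nat \<Rightarrow> complex) \<Rightarrow> real \<Rightarrow> complex" where
  "series q b v = indicator {..- ln (2 * q)} v *\<^sub>R (\<Sum>p. b p * exp (of_nat p * of_real v))"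

text \<open>The truncated Laplace transform of the series: the integral of \<open>K (ln u - w)\<close> times the series at
  \<open>u\<close> against \<open>du / u\<close> over \<open>0 < u \<le> 1 / (2 * q)\<close>, with \<open>u = exp v\<close>.\<close>

definition laplace :: "real \<Rightarrow> (nat \<Rightarrow> complex) \<Rightarrow> complex \<Rightarrow> complex" where
  "laplace q b w = (\<integral>v. K (of_real v - w) * series q b v \<partial>lborel)"

lemma series_measurable [measurable]: "series q b \<in> borel_measurable borel"
  unfolding series_def by measurable

lemma series_bound:
  assumes "q > 0" "\<And>p. norm (b p) \<le> C * q ^ p"
  shows "norm (series q b v) \<le> 2 * C"
  using power_series_bound(2)[OF assms(1) _ assms(2), of v 0] order_trans[OF norm_ge_zero assms(2)[of 0]]
  by (cases "v \<le> - ln (2 * q)") (auto simp: series_def)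

lemma series_integrable:
  assumes q: "q > 0" and b: "\<And>p. norm (b p) \<le> C * q ^ p" and w: "w \<in> sector r"
  shows "integrable lborel (\<lambda>v. K (of_real v - w) * series q b v)"
proof (rule Bochner_Integration.integrable_bound)
  show "integrable lborel (\<lambda>v. 2 * C * (K (of_real v - w) * exp (of_nat 0 * of_real v)))"
    using shifted_moment_integrable[OF w, of 0] by (intro Bochner_Integration.integrable_mult_right) auto
  show "(\<lambda>v. K (of_real v - w) * series q b v) \<in> borel_measurable lborel"
    using kernel_meas[OF w] by simp
  have C: "C \<ge> 0" using order_trans[OF norm_ge_zero b[of 0]] by simp
  show "AE v in lborel. norm (K (of_real v - w) * series q b v)
      \<le> norm (2 * C * (K (of_real v - w) * exp (of_nat 0 * of_real v)))"
    using series_bound[OF q b] C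
    by (intro AE_I2) (auto simp: norm_mult mult.commute intro!: mult_right_mono)
qed

lemma laplace_holomorphic:
  assumes q: "q > 0" and b: "\<And>p. norm (b p) \<le> C * q ^ p"
  shows "laplace q b holomorphic_on sector r"
proof (rule holomorphic_on_sector_if_bounded_parts)
  fix B
  obtain D where D: "\<And>w v. w \<in> sector r \<Longrightarrow> \<bar>Re w\<bar> < B \<Longrightarrow>
     norm (K (of_real v - w) * exp (of_nat 0 * of_real v)) \<le> D * exp (- \<bar>v\<bar>)"
    using shifted_kernel_uniform_bound[of B 0] by blast
  have C: "C \<ge> 0" using order_trans[OF norm_ge_zero b[of 0]] by simp
  have "(\<lambda>w. \<integral>v. K (of_real v - w) * series q b v \<partial>lborel) holomorphic_on (sector r \<inter> {w. \<bar>Re w\<bar> < B})"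
  proof (rule holomorphic_on_integral[where g = "\<lambda>v. (D * exp (- \<bar>v\<bar>)) * (2 * C)"])
    show "open (sector r \<inter> {w. \<bar>Re w\<bar> < B})"
      by (intro open_Int open_sector open_Collect_less continuous_intros)
    show "(\<lambda>w. K (of_real v - w) * series q b v) holomorphic_on (sector r \<inter> {w. \<bar>Re w\<bar> < B})" for v
      by (intro holomorphic_intros holomorphic_on_subset[OF kernel_shift_holomorphic]) auto
    show "(\<lambda>v. K (of_real v - w) * series q b v) \<in> borel_measurable lborel"
      if "w \<in> sector r \<inter> {w. \<bar>Re w\<bar> < B}" for w
      using kernel_meas[of w] that by simp
    show "norm (K (of_real v - w) * series q b v) \<le> (D * exp (- \<bar>v\<bar>)) * (2 * C)"
      if w: "w \<in> sector r \<inter> {w. \<bar>Re w\<bar> < B}" for w v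
      unfolding norm_mult
    proof (rule mult_mono)
      show *: "norm (K (of_real v - w)) \<le> D * exp (- \<bar>v\<bar>)" using D[of w v] w by simp
      show "norm (series q b v) \<le> 2 * C" by (rule series_bound[OF q b])
      show "0 \<le> D * exp (- \<bar>v\<bar>)" using order_trans[OF norm_ge_zero *] .
    qed simp
    show "integrable lborel (\<lambda>v. (D * exp (- \<bar>v\<bar>)) * (2 * C))"
      using integrable_exp_neg_abs by simp
  qed
  then show "laplace q b holomorphic_on (sector r \<inter> {w. \<bar>Re w\<bar> < B})"
    by (simp add: laplace_def[abs_def])
qed

text \<open>Since \<open>moment j * exp (j * w)\<close> is the full transform of \<open>exp (j * v)\<close>, the remainder is a single
  integral of the kernel against a function that satisfies both preceding bounds.\<close>

lemma laplace_expansion: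
  assumes q: "q > 0" and b: "\<And>p. norm (b p) \<le> C * q ^ p" and w: "w \<in> sector r"
  shows "norm (laplace q b w - (\<Sum>j<N. b j * moment j * exp (of_nat j * w)))
    \<le> 2 * C * (2 * q) ^ N * exp (real N * Re w) * (\<integral>v. exp (real N * v) * g v \<partial>lborel)"
proof -
  define H where "H v = series q b v - (\<Sum>j<N. b j * exp (of_nat j * of_real v))" for v
  have C: "C \<ge> 0" using order_trans[OF norm_ge_zero b[of 0]] by simp
  have H: "norm (H v) \<le> 2 * C * (2 * q * exp v) ^ N" for v
  proof (cases "v \<le> - ln (2 * q)")
    case True
    have "norm (H v) \<le> 2 * C * (q * exp v) ^ N"
      using power_series_bound(2)[OF q True b, of N] True by (simp add: H_def series_def)
    also have "\<dots> \<le> 2 * C * (2 * q * exp v) ^ N"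
      using C q by (intro mult_left_mono power_mono) auto
    finally show ?thesis .
  next
    case False
    then show ?thesis
      using polynomial_bound[OF q _ b, of v N] by (simp add: H_def series_def)
  qed
  have isum: "integrable lborel (\<lambda>v. \<Sum>j<N. b j * (K (of_real v - w) * exp (of_nat j * of_real v)))"
    by (intro Bochner_Integration.integrable_sum Bochner_Integration.integrable_mult_right
        shifted_moment_integrable[OF w])
  have "(\<Sum>j<N. b j * moment j * exp (of_nat j * w))
      = (\<Sum>j<N. \<integral>v. b j * (K (of_real v - w) * exp (of_nat j * of_real v)) \<partial>lborel)"
    using shifted_moment[OF w] by (simp add: mult.assoc)
  also have "\<dots> = (\<integral>v. (\<Sum>j<N. b j * (K (of_real v - w) * exp (of_nat j * of_real v))) \<partial>lborel)"
    by (rule Bochner_Integration.integral_sum[symmetric])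
      (intro Bochner_Integration.integrable_mult_right shifted_moment_integrable[OF w])
  finally have "laplace q b w - (\<Sum>j<N. b j * moment j * exp (of_nat j * w))
      = (\<integral>v. K (of_real v - w) * series q b v
          - (\<Sum>j<N. b j * (K (of_real v - w) * exp (of_nat j * of_real v))) \<partial>lborel)"
    unfolding laplace_def
    using Bochner_Integration.integral_diff[OF series_integrable[OF q b w] isum] by simp
  also have "\<dots> = (\<integral>v. K (of_real v - w) * H v \<partial>lborel)"
    by (intro Bochner_Integration.integral_cong)
      (auto simp: H_def right_diff_distrib sum_distrib_left mult_ac)
  also have "norm \<dots> \<le> (\<integral>v. 2 * C * (2 * q) ^ N * exp (real N * Re w)
      * (exp (real N * (v - Re w)) * g (v - Re w)) \<partial>lborel)"
  proof (rule Bochner_Integration.integral_norm_bound_integral)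
    show "integrable lborel (\<lambda>v. 2 * C * (2 * q) ^ N * exp (real N * Re w)
      * (exp (real N * (v - Re w)) * g (v - Re w)))"
      by (intro Bochner_Integration.integrable_mult_right shifted_g_integrable)
    have "integrable lborel (\<lambda>v. K (of_real v - w) * series q b v
          - (\<Sum>j<N. b j * (K (of_real v - w) * exp (of_nat j * of_real v))))"
      by (rule Bochner_Integration.integrable_diff[OF series_integrable[OF q b w] isum])
    then show "integrable lborel (\<lambda>v. K (of_real v - w) * H v)"
      by (simp add: H_def right_diff_distrib sum_distrib_left mult_ac)
    fix v
    have "norm (K (of_real v - w) * H v) \<le> g (v - Re w) * (2 * C * (2 * q * exp v) ^ N)"
      unfolding norm_mult using bound[OF shift_in_sector[OF w, of v]] H[of v] g_nonneg
      by (intro mult_mono) auto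
    also have "\<dots> = 2 * C * (2 * q) ^ N * exp (real N * Re w) * (exp (real N * (v - Re w)) * g (v - Re w))"
      by (simp add: power_mult_distrib exp_of_nat_mult[symmetric] exp_add[symmetric] algebra_simps
          flip: exp_of_nat_mult)
    finally show "norm (K (of_real v - w) * H v) \<le> 2 * C * (2 * q) ^ N * exp (real N * Re w)
      * (exp (real N * (v - Re w)) * g (v - Re w))" .
  qed
  also have "\<dots> = 2 * C * (2 * q) ^ N * exp (real N * Re w) * (\<integral>v. exp (real N * v) * g v \<partial>lborel)"
    by (simp add: shifted_g_integral)
  finally show ?thesis .
qed

end


section \<open>From asymptotic expansions to derivatives\<close>

lemma nth_deriv_exp_chart:
  assumes F: "F holomorphic_on D" and D: "open D" and U: "open U" "exp ` U \<subseteq> D"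
    and f: "\<And>v. v \<in> U \<Longrightarrow> f v = F (exp v)"
  shows "v \<in> U \<Longrightarrow> nth_deriv p f v = (deriv ^^ p) F (exp v)"
proof (induction p arbitrary: v)
  case 0
  then show ?case using f by simp
next
  case (Suc p)
  have "((deriv ^^ p) F has_field_derivative deriv ((deriv ^^ p) F) (exp v)) (at (exp v))"
    using Suc.prems U by (intro holomorphic_derivI[OF holomorphic_higher_deriv[OF F D] D]) auto
  from DERIV_chain2[OF this DERIV_exp]
  have "((\<lambda>v. (deriv ^^ p) F (exp v)) has_field_derivative deriv ((deriv ^^ p) F) (exp v) * exp v) (at v)" .
  then have "(nth_deriv p f has_field_derivative deriv ((deriv ^^ p) F) (exp v) * exp v) (at v)"
    by (rule has_field_derivative_transform_within_open[OF _ U(1) Suc.prems]) (simp add: Suc.IH)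
  then show ?case
    using surface_deriv_def[of "nth_deriv p f" v] by (simp add: DERIV_imp_deriv)
qed

lemma nth_deriv_cong:
  assumes "open S" "\<And>v. v \<in> S \<Longrightarrow> f v = g v"
  shows "v \<in> S \<Longrightarrow> nth_deriv p f v = nth_deriv p g v"
proof (induction p arbitrary: v)
  case (Suc p)
  have "eventually (\<lambda>u. u \<in> S) (nhds v)" using Suc.prems assms(1) by (rule eventually_nhds_in_open[rotated])
  then have "eventually (\<lambda>u. nth_deriv p f u = nth_deriv p g u) (nhds v)"
    by eventually_elim (rule Suc.IH)
  then show ?case
    using surface_deriv_def[of "nth_deriv p f" v] surface_deriv_def[of "nth_deriv p g" v]
    by (simp add: deriv_cong_ev)
qed (use assms in simp)

lemma higher_deriv_polynomial:
  "(deriv ^^ p) (\<lambda>z. \<Sum>j<N. a j * z ^ j) z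
    = (\<Sum>j<N. a j * (pochhammer (of_nat (Suc j - p)) p * z ^ (j - p)) :: complex)"
proof (induction N arbitrary: z)
  case 0
  then show ?case by (cases p) (simp_all add: higher_deriv_const)
next
  case (Suc N)
  have "(deriv ^^ p) (\<lambda>z. (\<Sum>j<N. a j * z ^ j) + a N * z ^ N) z
      = (deriv ^^ p) (\<lambda>z. \<Sum>j<N. a j * z ^ j) z + (deriv ^^ p) (\<lambda>z. a N * z ^ N) z"
    by (rule higher_deriv_add[where S = UNIV]) (auto intro!: holomorphic_intros)
  also have "(deriv ^^ p) (\<lambda>z. a N * z ^ N) z = a N * (deriv ^^ p) (\<lambda>z. z ^ N) z"
    by (rule higher_deriv_cmult[where A = UNIV]) (auto intro!: holomorphic_intros)
  also have "(deriv ^^ p) (\<lambda>z. z ^ N) z = pochhammer (of_nat (Suc N - p)) p * z ^ (N - p)"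
    using higher_deriv_power[of p 0 N z] by simp
  finally show ?case using Suc by simp
qed

lemma higher_deriv_polynomial_low:
  "(deriv ^^ p) (\<lambda>z. \<Sum>j<p. a j * z ^ j) z = (0 :: complex)"
  unfolding higher_deriv_polynomial by (intro sum.neutral) (auto simp: pochhammer_0_left)

lemma higher_deriv_polynomial_top:
  "(deriv ^^ p) (\<lambda>z. \<Sum>j<Suc p. a j * z ^ j) z = (fact p * a p :: complex)"
proof -
  have "(\<Sum>j<p. a j * (pochhammer (of_nat (Suc j - p)) p * z ^ (j - p))) = 0"
    by (intro sum.neutral) (auto simp: pochhammer_0_left)
  then show ?thesis unfolding higher_deriv_polynomial by (simp add: pochhammer_fact)
qed

text \<open>An opening \<open>\<epsilon>\<close> such that the disc of radius \<open>\<epsilon> \<bar>z\<bar>\<close> around a point \<open>z\<close> of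
  the sector of opening \<open>\<gamma>\<close> lies in the sector of opening \<open>r\<close>.\<close>

lemma sector_margin:
  assumes "\<gamma> < r"
  obtains \<epsilon> :: real where "0 < \<epsilon>" "\<epsilon> < 1"
    "\<And>w \<xi> :: complex. w \<in> sector \<gamma> \<Longrightarrow> \<xi> \<in> ball 1 \<epsilon> \<Longrightarrow> w + Ln \<xi> \<in> sector r"
proof -
  have pos: "(r - \<gamma>) * pi / 2 > 0" using assms by simp
  have "((\<lambda>\<xi>. Im (Ln \<xi>)) \<longlongrightarrow> Im (Ln 1)) (at 1)"
    by (intro tendsto_intros) auto
  then have "eventually (\<lambda>\<xi>. \<bar>Im (Ln \<xi>)\<bar> < (r - \<gamma>) * pi / 2) (at 1)"
    using pos by (auto simp: tendsto_iff dist_norm simp del: divide_less_eq_numeral1 less_divide_eq_numeral1)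
  then obtain d where d: "d > 0" "\<And>\<xi>. \<xi> \<noteq> 1 \<Longrightarrow> dist \<xi> 1 < d \<Longrightarrow> \<bar>Im (Ln \<xi>)\<bar> < (r - \<gamma>) * pi / 2"
    by (auto simp: eventually_at)
  show ?thesis
  proof (rule that[of "min d (1 / 2)"])
    fix w \<xi> :: complex assume w: "w \<in> sector \<gamma>" and \<xi>: "\<xi> \<in> ball 1 (min d (1 / 2))"
    have "\<bar>Im (Ln \<xi>)\<bar> < (r - \<gamma>) * pi / 2"
      using d(2)[of \<xi>] \<xi> pos by (cases "\<xi> = 1") (auto simp: dist_commute)
    then show "w + Ln \<xi> \<in> sector r"
      using w abs_triangle_ineq[of "Im w" "Im (Ln \<xi>)"] by (simp add: sector_iff field_simps)
  qed (use d in auto)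
qed

text \<open>Uniform asymptotics with remainders \<open>M N * \<bar>z\<bar> ^ N\<close> on the larger sector bound all derivatives on
  the smaller one. On the disc around \<open>z0 = exp w\<close> the function is transported to the plane, and
  Cauchy's estimate is applied to its remainder of order \<open>p\<close>, whose \<open>p\<close>-th derivative is that of the
  function, and to its remainder of order \<open>p + 1\<close>, which yields the limit at the vertex.\<close>

lemma asymptotic_expansion_derivatives:
  fixes a :: "nat \<Rightarrow> complex" and M :: "nat \<Rightarrow> real"
  assumes eps: "0 < \<epsilon>" "\<epsilon> < 1"
      "\<And>w \<xi>. w \<in> sector \<gamma> \<Longrightarrow> \<xi> \<in> ball 1 \<epsilon> \<Longrightarrow> w + Ln \<xi> \<in> sector r"
    and f: "f holomorphic_on sector r"
    and exp_bound: "\<And>w N. w \<in> sector r \<Longrightarrow>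
      norm (f w - (\<Sum>j<N. a j * exp (of_nat j * w))) \<le> M N * exp (real N * Re w)"
    and w: "w \<in> sector \<gamma>"
  shows "norm (nth_deriv p f w) \<le> fact p * M p * (4 / \<epsilon>) ^ p" (is ?bound)
    and "norm (nth_deriv p f w - fact p * a p) \<le> fact p * M (Suc p) * 2 * (4 / \<epsilon>) ^ p * exp (Re w)" (is ?lim)
proof -
  define z0 where "z0 = exp w"
  define \<phi> where "\<phi> z = w + Ln (z / z0)" for z
  define D where "D = ball z0 (\<epsilon> * norm z0)"
  define F where "F z = f (\<phi> z)" for z
  have z0: "z0 \<noteq> 0" "norm z0 = exp (Re w)" by (auto simp: z0_def)
  have quot: "z / z0 \<in> ball 1 \<epsilon>" if "z \<in> D" for z
  proof -
    have "z / z0 - 1 = (z - z0) / z0" using z0 by (simp add: field_simps)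
    then have "norm (1 - z / z0) = norm (z - z0) / norm z0"
      by (metis norm_divide norm_minus_commute)
    also have "\<dots> < \<epsilon>" using that z0 by (simp add: D_def dist_norm norm_minus_commute divide_less_eq)
    finally show ?thesis by (simp add: dist_norm)
  qed
  have slit: "z / z0 \<notin> \<real>\<^sub>\<le>\<^sub>0" if "z \<in> D" for z
  proof
    assume "z / z0 \<in> \<real>\<^sub>\<le>\<^sub>0"
    then have "Re (1 - z / z0) \<ge> 1" by (auto elim!: nonpos_Reals_cases)
    then have "norm (1 - z / z0) \<ge> 1" using complex_Re_le_cmod order_trans by blast
    then show False using quot[OF that] eps by (auto simp: dist_norm)
  qed
  have phi: "\<phi> z \<in> sector r" "exp (\<phi> z) = z" if "z \<in> D" for z
  proof -
    show "\<phi> z \<in> sector r" unfolding \<phi>_def by (rule eps(3)[OF w quot[OF that]])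
    have "z / z0 \<noteq> 0" using slit[OF that] by auto
    then show "exp (\<phi> z) = z" using z0 by (simp add: \<phi>_def exp_add z0_def)
  qed
  have hol_phi: "\<phi> holomorphic_on D"
    unfolding \<phi>_def using slit z0 by (auto intro!: holomorphic_intros)
  have hol_F: "F holomorphic_on D"
    using holomorphic_on_compose_gen[OF hol_phi f] phi by (auto simp: F_def[abs_def] comp_def)
  have z0D: "z0 \<in> D" using eps z0 by (simp add: D_def)
  \<comment> \<open>The restriction on the imaginary part selects the sheet on which \<open>\<phi>\<close> inverts \<open>exp\<close>.\<close>
  define U where "U = {v. \<bar>Im (v - w)\<bar> < pi} \<inter> exp -` D"
  have "open U"
    unfolding U_def D_def
    by (intro open_Int open_Collect_less open_vimage continuous_intros) auto
  moreover have "f v = F (exp v)" if "v \<in> U" for v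
  proof -
    have "Ln (exp v / z0) = v - w"
      using that unfolding z0_def exp_diff[symmetric] by (intro Ln_exp) (auto simp: U_def)
    then show ?thesis by (simp add: F_def \<phi>_def)
  qed
  moreover have "w \<in> U" using z0D by (simp add: U_def z0_def)
  ultimately have nth: "nth_deriv p f w = (deriv ^^ p) F z0"
    using nth_deriv_exp_chart[OF hol_F, of U f w p] by (auto simp: z0_def D_def U_def)
  have remainder: "norm ((deriv ^^ p) F z0 - (deriv ^^ p) (\<lambda>z. \<Sum>j<N. a j * z ^ j) z0)
      \<le> fact p * (M N * (2 * norm z0) ^ N) / (\<epsilon> / 2 * norm z0) ^ p" for N
  proof -
    let ?Q = "\<lambda>z. F z - (\<Sum>j<N. a j * z ^ j)"
    have sub: "cball z0 (\<epsilon> / 2 * norm z0) \<subseteq> D"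
      using eps z0 unfolding D_def by (intro cball_subset_ball_iff[THEN iffD2]) auto
    have M: "M N \<ge> 0"
    proof -
      have "0 \<le> M N * exp (real N * Re w)"
        using order_trans[OF norm_ge_zero exp_bound[of w N]] phi(1)[OF z0D] z0 by (simp add: \<phi>_def)
      then show ?thesis by (simp add: zero_le_mult_iff)
    qed
    have holQ: "?Q holomorphic_on D" by (intro holomorphic_intros hol_F)
    have "norm ((deriv ^^ p) ?Q z0) \<le> fact p * (M N * (2 * norm z0) ^ N) / (\<epsilon> / 2 * norm z0) ^ p"
    proof (rule Cauchy_inequality)
      show "?Q holomorphic_on ball z0 (\<epsilon> / 2 * norm z0)"
        using holQ sub ball_subset_cball holomorphic_on_subset by blast
      show "continuous_on (cball z0 (\<epsilon> / 2 * norm z0)) ?Q"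
        using holQ sub holomorphic_on_subset holomorphic_on_imp_continuous_on by blast
      show "0 < \<epsilon> / 2 * norm z0" using eps z0 by simp
      fix z assume z: "norm (z0 - z) = \<epsilon> / 2 * norm z0"
      then have zD: "z \<in> D" using sub by (auto simp: dist_norm)
      have expj: "exp (of_nat j * \<phi> z) = z ^ j" for j
        using phi(2)[OF zD] by (simp add: exp_of_nat_mult)
      have normz: "exp (Re (\<phi> z)) = norm z" using phi(2)[OF zD] by (metis norm_exp_eq_Re)
      have "norm z \<le> 2 * norm z0"
      proof -
        have "norm z \<le> norm z0 + norm (z0 - z)" by (metis norm_minus_commute norm_triangle_sub)
        also have "norm (z0 - z) \<le> 1 * norm z0" unfolding z using eps by (intro mult_right_mono) auto
        finally show ?thesis by simp
      qed
      have "norm (?Q z) \<le> M N * norm z ^ N"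
        using exp_bound[OF phi(1)[OF zD], of N] normz unfolding expj by (simp add: F_def exp_of_nat_mult)
      also have "M N * norm z ^ N \<le> M N * (2 * norm z0) ^ N"
        using M \<open>norm z \<le> 2 * norm z0\<close> by (intro mult_left_mono power_mono) auto
      finally show "norm (?Q z) \<le> M N * (2 * norm z0) ^ N" .
    qed
    also have "(deriv ^^ p) ?Q z0 = (deriv ^^ p) F z0 - (deriv ^^ p) (\<lambda>z. \<Sum>j<N. a j * z ^ j) z0"
      using hol_F z0D by (intro higher_deriv_diff[where S = D]) (auto simp: D_def intro!: holomorphic_intros)
    finally show ?thesis .
  qed
  show ?bound
    using remainder[of p] eps z0
    by (simp add: higher_deriv_polynomial_low nth power_divide power_mult_distrib field_simps)
      (simp add: power_mult_distrib[symmetric])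
  show ?lim
    using remainder[of "Suc p"] eps z0
    by (simp add: higher_deriv_polynomial_top nth power_divide power_mult_distrib field_simps del: sum.lessThan_Suc)
      (simp add: power_mult_distrib[symmetric])
qed

section \<open>The Borel map\<close>

lemma at_vertex_tendsto_exp_Re: "((\<lambda>w. exp (Re w)) \<longlongrightarrow> 0) (at_vertex S)"
proof -
  have "(exp \<longlongrightarrow> (0::complex)) (filtercomap exp (nhds 0))"
    by (simp add: filterlim_filtercomap)
  then have "(exp \<longlongrightarrow> (0::complex)) (at_vertex S)"
    unfolding at_vertex_def by (rule filterlim_mono) auto
  from tendsto_norm[OF this] show ?thesis by simp
qed

lemma at_vertex_sector_neq_bot:
  assumes "0 < \<gamma>"
  shows "at_vertex (sector \<gamma>) \<noteq> bot"
proof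
  assume bot: "at_vertex (sector \<gamma>) = bot"
  have "((\<lambda>n. of_real (exp (- real n)) :: complex) \<longlongrightarrow> of_real 0) sequentially"
    by (intro tendsto_of_real filterlim_compose[OF exp_at_bot]
        filterlim_compose[OF filterlim_uminus_at_bot_at_top filterlim_real_sequentially])
  then have "filterlim (\<lambda>n. exp (of_real (- real n)) :: complex) (nhds 0) sequentially"
    by (simp flip: exp_of_real)
  then have "filterlim (\<lambda>n. of_real (- real n) :: complex) (at_vertex (sector \<gamma>)) sequentially"
    unfolding at_vertex_def
    using assms by (auto simp: filterlim_inf filterlim_filtercomap_iff comp_def filterlim_principal sector_iff)
  then show False unfolding bot by (auto simp: filterlim_def le_bot filtermap_bot_iff dest!: bot.extremum_uniqueI)
qed

lemma borel_map_eq: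
  assumes "0 < \<gamma>"
    and "\<And>w p. w \<in> sector \<gamma> \<Longrightarrow> norm (nth_deriv p f w - c p) \<le> B p * exp (Re w)"
  shows "borel_map (sector \<gamma>) f = c"
proof
  fix p
  have "((\<lambda>w. nth_deriv p f w - c p) \<longlongrightarrow> 0) (at_vertex (sector \<gamma>))"
  proof (rule Lim_null_comparison)
    have "eventually (\<lambda>w. w \<in> sector \<gamma>) (at_vertex (sector \<gamma>))"
      unfolding at_vertex_def eventually_inf_principal by (rule always_eventually) simp
    then show "\<forall>\<^sub>F w in at_vertex (sector \<gamma>). norm (nth_deriv p f w - c p) \<le> B p * exp (Re w)"
      by eventually_elim (rule assms(2))
    show "((\<lambda>w. B p * exp (Re w)) \<longlongrightarrow> 0) (at_vertex (sector \<gamma>))"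
      by (rule tendsto_mult_right_zero[OF at_vertex_tendsto_exp_Re])
  qed
  then have "(nth_deriv p f \<longlongrightarrow> c p) (at_vertex (sector \<gamma>))" by (simp add: LIM_zero_iff)
  then show "borel_map (sector \<gamma>) f p = c p"
    unfolding borel_map_def by (intro tendsto_Lim at_vertex_sector_neq_bot assms)
qed


section \<open>A holomorphic function with real part comparable to a weight function\<close>

text \<open>The kernel \<open>\<zeta> / (1 + \<zeta>)\<^sup>2\<close> has nonnegative real part on the closed right half-plane because,
  for \<open>\<zeta> \<noteq> 0\<close>, its reciprocal is \<open>\<zeta> + 1 / \<zeta> + 2\<close>. The estimates are quantitative versions of
  this.\<close>

lemma stieltjes_kernel:
  fixes \<zeta> :: complex
  assumes "Re \<zeta> \<ge> 0"
  shows one_plus_norm_ge: "1 \<le> norm (1 + \<zeta>)"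
    and Re_stieltjes_kernel: "2 * norm \<zeta> ^ 2 / norm (1 + \<zeta>) ^ 4 \<le> Re (\<zeta> / (1 + \<zeta>)\<^sup>2)"
proof -
  show ge: "1 \<le> norm (1 + \<zeta>)"
    using complex_Re_le_cmod[of "1 + \<zeta>"] assms by simp
  have "Re (\<zeta> / (1 + \<zeta>)\<^sup>2) = Re (\<zeta> * cnj ((1 + \<zeta>)\<^sup>2)) / (norm ((1 + \<zeta>)\<^sup>2))\<^sup>2"
    by (subst complex_div_cnj) (simp flip: of_real_power)
  also have "(norm ((1 + \<zeta>)\<^sup>2))\<^sup>2 = norm (1 + \<zeta>) ^ 4"
    by (simp add: norm_power flip: power_mult)
  also have "Re (\<zeta> * cnj ((1 + \<zeta>)\<^sup>2)) = Re \<zeta> * (1 + norm \<zeta> ^ 2) + 2 * norm \<zeta> ^ 2"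
    unfolding cmod_power2 by (simp add: power2_eq_square algebra_simps)
  finally have *: "Re (\<zeta> / (1 + \<zeta>)\<^sup>2) = (Re \<zeta> * (1 + norm \<zeta> ^ 2) + 2 * norm \<zeta> ^ 2) / norm (1 + \<zeta>) ^ 4" .
  show "2 * norm \<zeta> ^ 2 / norm (1 + \<zeta>) ^ 4 \<le> Re (\<zeta> / (1 + \<zeta>)\<^sup>2)"
    unfolding * using assms by (intro divide_right_mono) auto
qed

lemma Re_stieltjes_kernel_ge:
  fixes \<zeta> :: complex
  assumes "Re \<zeta> \<ge> 0" "norm \<zeta> \<le> 1"
  shows "norm \<zeta> ^ 2 / 8 \<le> Re (\<zeta> / (1 + \<zeta>)\<^sup>2)"
proof -
  have "norm (1 + \<zeta>) \<le> 2" using norm_triangle_ineq[of 1 \<zeta>] assms by simp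
  then have "norm (1 + \<zeta>) ^ 4 \<le> 2 ^ 4" by (intro power_mono) auto
  moreover have "1 ^ 4 \<le> norm (1 + \<zeta>) ^ 4"
    using one_plus_norm_ge[OF assms(1)] by (intro power_mono) auto
  ultimately have "2 * norm \<zeta> ^ 2 / 2 ^ 4 \<le> 2 * norm \<zeta> ^ 2 / norm (1 + \<zeta>) ^ 4"
    by (intro divide_left_mono) auto
  also note Re_stieltjes_kernel[OF assms(1)]
  finally show ?thesis by simp
qed

text \<open>A normalized weight function, extended by zero to the negative axis, with
  \<open>log t = o(\<omega> t)\<close> and \<open>\<omega>(s) s powr (- 1 - 1 / r)\<close> integrable. As \<open>\<omega>\<close> vanishes up to 1, that integral over the line is
  the integral over \<open>[1, \<infinity>)\<close>.\<close>

locale gamma_weight =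
  fixes \<omega> :: "real \<Rightarrow> real" and r :: real
  assumes cont: "continuous_on UNIV \<omega>"
    and mono: "mono \<omega>"
    and zero: "\<And>t. t \<le> 1 \<Longrightarrow> \<omega> t = 0"
    and r: "0 < r"
    and integrable_j: "integrable lborel (\<lambda>s. \<omega> s * s powr (- 1 - 1 / r))"
    and ln_small: "ln \<in> o[at_top](\<omega>)"
begin

abbreviation j :: "real \<Rightarrow> real" where "j s \<equiv> \<omega> s * s powr (- 1 - 1 / r)"

definition kappa_integrand :: "real \<Rightarrow> real \<Rightarrow> real" where
  "kappa_integrand t u = indicator {1..} u * (\<omega> (t * u) * u powr (- 1 - 1 / r))"

text \<open>The left-hand side of the condition \<open>(\<tau>,\<omega>)\<close> of type \<open>\<gamma>\<^sub>r\<close>, as a function of \<open>t\<close>.\<close>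

definition kappa :: "real \<Rightarrow> real" where
  "kappa t = (\<integral>u. kappa_integrand t u \<partial>lborel)"

lemma omega_measurable [measurable]: "\<omega> \<in> borel_measurable borel"
  by (rule borel_measurable_continuous_onI[OF cont])

lemma omega_nonneg: "0 \<le> \<omega> t"
  using zero[of "min t 1"] monoD[OF mono, of "min t 1" t] by simp

lemma j_nonneg: "0 \<le> j s"
  using omega_nonneg by simp

lemma kappa_integrand_measurable [measurable]: "kappa_integrand t \<in> borel_measurable borel"
  unfolding kappa_integrand_def by measurable

lemma kappa_integrand_nonneg: "0 \<le> kappa_integrand t u"
  unfolding kappa_integrand_def using omega_nonneg by simp

lemma kappa_integrand_scale:
  assumes "t > 0"
  shows "kappa_integrand t u = t powr (1 + 1 / r) * (indicator {t..} (t * u) * j (t * u))"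
proof (cases "u \<ge> 1")
  case True
  then have "(t * u) powr (- 1 - 1 / r) = t powr (- 1 - 1 / r) * u powr (- 1 - 1 / r)"
    by (simp add: powr_mult)
  moreover have "t powr (1 + 1 / r) * t powr (- 1 - 1 / r) = 1"
    using assms by (simp flip: powr_add)
  ultimately have "t powr (1 + 1 / r) * (t * u) powr (- 1 - 1 / r) = u powr (- 1 - 1 / r)"
    by (simp flip: mult.assoc)
  then show ?thesis
    using True assms by (simp add: kappa_integrand_def mult_ac)
qed (use assms in \<open>simp add: kappa_integrand_def\<close>)

lemma integrable_tail: "integrable lborel (\<lambda>s. indicator {t..} s * j s)"
  by (rule Bochner_Integration.integrable_bound[OF integrable_j])
    (auto intro!: AE_I2 simp: indicator_def)

lemma kappa_integrable:
  assumes "t \<ge> 0"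
  shows "integrable lborel (kappa_integrand t)"
proof (cases "t = 0")
  case True
  then have "kappa_integrand t = (\<lambda>u. 0)" by (auto simp: kappa_integrand_def zero)
  then show ?thesis by simp
next
  case False
  then have t: "t > 0" using assms by simp
  have "integrable lborel (\<lambda>u. t powr (1 + 1 / r) * (indicator {t..} (0 + t * u) * j (0 + t * u)))"
    using lborel_integrable_real_affine[OF integrable_tail[of t], of t 0] t
    by (intro Bochner_Integration.integrable_mult_right) simp
  then show ?thesis
    by (simp add: kappa_integrand_scale[OF t, abs_def])
qed

lemma kappa_eq_tail:
  assumes t: "t > 0"
  shows "kappa t = t powr (1 / r) * (\<integral>s. indicator {t..} s * j s \<partial>lborel)"
proof -
  have "(\<integral>s. indicator {t..} s * j s \<partial>lborel) = t * (\<integral>u. indicator {t..} (t * u) * j (t * u) \<partial>lborel)"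
    using lborel_integral_real_affine[of t "\<lambda>s. indicator {t..} s * j s" 0] t by simp
  moreover have "kappa t = t powr (1 + 1 / r) * (\<integral>u. indicator {t..} (t * u) * j (t * u) \<partial>lborel)"
    unfolding kappa_def kappa_integrand_scale[OF t, abs_def]
    by (rule Bochner_Integration.integral_mult_right_zero)
  ultimately show ?thesis using t by (simp add: powr_add)
qed

lemma kappa_nonneg: "0 \<le> kappa t"
  unfolding kappa_def by (intro Bochner_Integration.integral_nonneg kappa_integrand_nonneg)

lemma kappa_integrand_mono: "s \<le> t \<Longrightarrow> kappa_integrand s u \<le> kappa_integrand t u"
  unfolding kappa_integrand_def
  by (cases "u \<ge> 1") (auto intro!: mult_right_mono monoD[OF mono])

lemma kappa_mono: "0 \<le> s \<Longrightarrow> s \<le> t \<Longrightarrow> kappa s \<le> kappa t"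
  unfolding kappa_def by (intro integral_mono kappa_integrable kappa_integrand_mono) auto

lemma kappa_ge_omega:
  assumes "t \<ge> 0"
  shows "2 powr (- 1 - 1 / r) * \<omega> t \<le> kappa t"
proof -
  have "(\<integral>u. indicator {1..2::real} u * (2 powr (- 1 - 1 / r) * \<omega> t) \<partial>lborel) \<le> kappa t"
    unfolding kappa_def
  proof (rule integral_mono)
    fix u :: real
    show "indicator {1..2} u * (2 powr (- 1 - 1 / r) * \<omega> t) \<le> kappa_integrand t u"
    proof (cases "u \<in> {1..2}")
      case True
      have "2 powr (- 1 - 1 / r) \<le> u powr (- 1 - 1 / r)"
      proof (rule powr_mono2')
        have "1 / r > 0" using r by simp
        then show "- 1 - 1 / r \<le> 0" by linarith
      qed (use True in auto)
      moreover have "\<omega> t \<le> \<omega> (t * u)"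
        using True assms by (intro monoD[OF mono]) (simp add: mult_le_cancel_left1)
      ultimately show ?thesis
        using True omega_nonneg by (auto simp: kappa_integrand_def mult.commute intro!: mult_mono)
    qed (simp add: kappa_integrand_nonneg)
  qed (use assms in \<open>auto intro: kappa_integrable\<close>)
  then show ?thesis by simp
qed

lemma kappa_continuous: "continuous_on {0..} kappa"
  unfolding continuous_on_sequentially
proof (intro allI impI ballI, elim conjE)
  fix x :: "nat \<Rightarrow> real" and a assume a: "a \<in> {0..}" and x: "\<forall>n. x n \<in> {0..}" "x \<longlonglongrightarrow> a"
  obtain T where T: "T > 0" "\<And>n. \<bar>x n\<bar> \<le> T"
    using convergent_imp_Bseq[OF convergentI[OF x(2)]] by (auto simp: Bseq_def)
  show "(kappa \<circ> x) \<longlonglongrightarrow> kappa a"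
    unfolding comp_def kappa_def
  proof (rule integral_dominated_convergence[where w = "kappa_integrand T"])
    show "AE u in lborel. (\<lambda>n. kappa_integrand (x n) u) \<longlonglongrightarrow> kappa_integrand a u"
    proof (rule AE_I2)
      fix u
      have "isCont \<omega> (a * u)" using cont by (simp add: continuous_on_eq_continuous_at)
      then have "(\<lambda>n. \<omega> (x n * u)) \<longlonglongrightarrow> \<omega> (a * u)"
        by (rule isCont_tendsto_compose) (intro tendsto_intros x(2))
      then show "(\<lambda>n. kappa_integrand (x n) u) \<longlonglongrightarrow> kappa_integrand a u"
        unfolding kappa_integrand_def by (intro tendsto_intros)
    qed
    show "AE u in lborel. norm (kappa_integrand (x n) u) \<le> kappa_integrand T u" for n
      using kappa_integrand_mono[of "x n" T] T(2)[of n] kappa_integrand_nonneg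
      by (intro AE_I2) auto
  qed (use T in \<open>auto intro: kappa_integrable\<close>)
qed

text \<open>The power \<open>(z / s) powr (1 / r)\<close> at \<open>z = exp w\<close>. It maps the sector of opening \<open>r\<close> to the right
  half-plane. Its values for \<open>s \<le> 0\<close> do not matter, since \<open>\<omega>\<close> vanishes there.\<close>

definition zeta :: "complex \<Rightarrow> real \<Rightarrow> complex" where
  "zeta w s = exp (w / of_real r) * of_real (s powr (- 1 / r))"

text \<open>For \<open>s > 0\<close> the integrand is \<open>\<omega> s / (r * s) * \<zeta> / (1 + \<zeta>)\<^sup>2\<close> with \<open>\<zeta> = zeta w s\<close>; it
  is written so that the integrable factor \<open>j\<close> stands alone. The function \<open>F\<close> is a Poisson-type integral
  of \<open>\<omega>\<close>: up to partial integration, the Stieltjes integral of \<open>\<zeta> / (1 + \<zeta>)\<close> against \<open>d\<omega>\<close>.\<close>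

definition F_integrand :: "complex \<Rightarrow> real \<Rightarrow> complex" where
  "F_integrand w s = of_real (j s) * (exp (w / of_real r) / (of_real r * (1 + zeta w s)\<^sup>2))"

definition F :: "complex \<Rightarrow> complex" where
  "F w = (\<integral>s. F_integrand w s \<partial>lborel)"

definition lower_const :: real where
  "lower_const = 2 powr (- 2 / r) / (16 * r)"

definition upper_const :: real where
  "upper_const = 1 / r + 1 / 2 powr (- 1 - 1 / r)"

lemma lower_const_pos: "0 < lower_const" and upper_const_pos: "0 < upper_const"
  using r by (auto simp: lower_const_def upper_const_def intro!: add_pos_pos divide_pos_pos)

lemma Re_zeta_nonneg:
  assumes "w \<in> sector r"
  shows "0 \<le> Re (zeta w s)"
proof -
  have "\<bar>Im w / r\<bar> \<le> pi / 2" using assms r by (simp add: sector_iff field_simps)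
  then have "0 \<le> cos (Im w / r)" unfolding abs_le_iff by (intro cos_ge_zero) linarith+
  then show ?thesis by (simp add: zeta_def Re_exp)
qed

lemma norm_zeta: "norm (zeta w s) = exp (Re w / r) * s powr (- 1 / r)"
  by (simp add: zeta_def norm_mult)

lemma F_integrand_eq:
  assumes "s > 0"
  shows "F_integrand w s = of_real (\<omega> s / (r * s)) * (zeta w s / (1 + zeta w s)\<^sup>2)"
proof -
  have "s powr (- 1 - 1 / r) = s powr (- 1 / r) / s"
    using assms by (simp add: powr_diff powr_minus field_simps)
  then show ?thesis by (simp add: F_integrand_def zeta_def mult_ac)
qed

lemma F_integrand_measurable [measurable]: "F_integrand w \<in> borel_measurable borel"
  unfolding F_integrand_def zeta_def by measurable

lemma norm_F_integrand_le:
  assumes "w \<in> sector r"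
  shows "norm (F_integrand w s) \<le> j s * (exp (Re w / r) / r)"
proof -
  have "1 \<le> norm (1 + zeta w s) ^ 2"
    using one_plus_norm_ge[OF Re_zeta_nonneg[OF assms]] by simp
  then have "exp (Re w / r) / (r * norm (1 + zeta w s) ^ 2) \<le> exp (Re w / r) / r"
    using r one_plus_norm_ge[OF Re_zeta_nonneg[OF assms], of s]
    by (intro divide_left_mono) (auto intro!: mult_pos_pos zero_less_power)
  then have "j s * (exp (Re w / r) / (r * norm (1 + zeta w s) ^ 2)) \<le> j s * (exp (Re w / r) / r)"
    by (intro mult_left_mono j_nonneg)
  then show ?thesis
    using r j_nonneg[of s] omega_nonneg
    by (simp add: F_integrand_def norm_mult norm_divide norm_power)
qed

lemma F_integrable:
  assumes "w \<in> sector r"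
  shows "integrable lborel (F_integrand w)"
proof (rule Bochner_Integration.integrable_bound)
  show "integrable lborel (\<lambda>s. j s * (exp (Re w / r) / r))"
    using integrable_j by simp
  show "AE s in lborel. norm (F_integrand w s) \<le> norm (j s * (exp (Re w / r) / r))"
    using norm_F_integrand_le[OF assms] by (intro AE_I2) (metis abs_ge_self order_trans real_norm_def)
qed simp

lemma F_holomorphic: "F holomorphic_on sector r"
proof (rule holomorphic_on_sector_if_bounded_parts)
  fix B
  show "F holomorphic_on (sector r \<inter> {w. \<bar>Re w\<bar> < B})"
    unfolding F_def
  proof (rule holomorphic_on_integral[where g = "\<lambda>s. j s * (exp (B / r) / r)"])
    show "open (sector r \<inter> {w. \<bar>Re w\<bar> < B})"
      by (intro open_Int open_sector open_Collect_less continuous_intros)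
    show "(\<lambda>w. F_integrand w s) holomorphic_on (sector r \<inter> {w. \<bar>Re w\<bar> < B})" for s
    proof -
      have "1 + zeta w s \<noteq> 0" if "w \<in> sector r" for w
        using one_plus_norm_ge[OF Re_zeta_nonneg[OF that, of s]] by auto
      then show ?thesis
        using r unfolding F_integrand_def zeta_def by (auto intro!: holomorphic_intros)
    qed
    show "norm (F_integrand w s) \<le> j s * (exp (B / r) / r)"
      if w: "w \<in> sector r \<inter> {w. \<bar>Re w\<bar> < B}" for w s
    proof -
      have "norm (F_integrand w s) \<le> j s * (exp (Re w / r) / r)"
        using norm_F_integrand_le w by blast
      also have "\<dots> \<le> j s * (exp (B / r) / r)"
        using w r by (intro mult_left_mono j_nonneg divide_right_mono) (auto simp: divide_right_mono)
      finally show ?thesis .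
    qed
    show "integrable lborel (\<lambda>s. j s * (exp (B / r) / r))"
      using integrable_j by simp
  qed simp
qed

text \<open>The integrand has nonnegative real part, and the part of the integral over \<open>[t, 2 * t]\<close> with
  \<open>t = \<bar>z\<bar>\<close> alone gives the bound.\<close>

lemma Re_F_ge:
  assumes w: "w \<in> sector r"
  shows "lower_const * \<omega> (exp (Re w)) \<le> Re (F w)"
proof -
  define t where "t = exp (Re w)"
  have t: "t > 0" by (simp add: t_def)
  define c where "c = \<omega> t / (2 * r * t) * (2 powr (- 2 / r) / 8)"
  have pw: "indicator {t..2 * t} s * c \<le> Re (F_integrand w s)" for s
  proof (cases "s > 0")
    case True
    have Re_eq: "Re (F_integrand w s) = \<omega> s / (r * s) * Re (zeta w s / (1 + zeta w s)\<^sup>2)"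
      unfolding F_integrand_eq[OF True] by (simp only: Re_complex_of_real Im_complex_of_real times_complex.sel mult_zero_left diff_0_right)
    have nn: "0 \<le> \<omega> s / (r * s)" using omega_nonneg True r by simp
    show ?thesis
    proof (cases "s \<in> {t..2 * t}")
      case s: True
      have nz: "norm (zeta w s) = (t / s) powr (1 / r)"
        using t True by (simp add: norm_zeta t_def powr_divide powr_minus divide_simps exp_powr_real)
      have "norm (zeta w s) \<le> 1"
        unfolding nz using s True t r by (intro powr_le1) auto
      have "2 powr (- 2 / r) = (1 / 2) powr (1 / r) * (1 / 2) powr (1 / r)"
        by (simp add: powr_divide powr_minus divide_simps flip: powr_add)
      also have "\<dots> \<le> (t / s) powr (1 / r) * (t / s) powr (1 / r)"
        using s True r by (intro mult_mono powr_mono2) (auto simp: field_simps)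
      finally have "2 powr (- 2 / r) / 8 \<le> norm (zeta w s) ^ 2 / 8"
        by (simp add: nz power2_eq_square)
      also have "\<dots> \<le> Re (zeta w s / (1 + zeta w s)\<^sup>2)"
        by (rule Re_stieltjes_kernel_ge[OF Re_zeta_nonneg[OF w]]) fact
      finally have 1: "2 powr (- 2 / r) / 8 \<le> Re (zeta w s / (1 + zeta w s)\<^sup>2)" .
      have 2: "\<omega> t / (2 * r * t) \<le> \<omega> s / (r * s)"
        using s True r t omega_nonneg by (intro frac_le monoD[OF mono]) auto
      show ?thesis
        unfolding Re_eq c_def using s mult_mono[OF 2 1 nn] by simp
    next
      case False
      have "0 \<le> 2 * norm (zeta w s) ^ 2 / norm (1 + zeta w s) ^ 4" by simp
      also note Re_stieltjes_kernel[OF Re_zeta_nonneg[OF w, of s]]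
      finally show ?thesis using False unfolding Re_eq using mult_nonneg_nonneg[OF nn] by simp
    qed
  next
    case False
    then have "\<omega> s = 0" using zero by simp
    then show ?thesis using False t by (simp add: F_integrand_def)
  qed
  have "lower_const * \<omega> t = (\<integral>s. indicator {t..2 * t} s * c \<partial>lborel)"
    using t r by (simp add: lower_const_def c_def)
  also have "\<dots> \<le> (\<integral>s. Re (F_integrand w s) \<partial>lborel)"
    using t F_integrable[OF w] pw by (intro integral_mono) auto
  also have "\<dots> = Re (F w)"
    unfolding F_def using F_integrable[OF w] by (rule integral_Re)
  finally show ?thesis by (simp add: t_def)
qed

text \<open>The real values of \<open>F\<close> on the ray \<open>arg z = 0\<close>.\<close>

definition Fr :: "real \<Rightarrow> real" where
  "Fr x = (\<integral>s. j s * (exp (x / r) / (r * (1 + exp (x / r) * s powr (- 1 / r))\<^sup>2)) \<partial>lborel)"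

lemma F_integrand_of_real:
  "F_integrand (of_real x) s
    = of_real (j s * (exp (x / r) / (r * (1 + exp (x / r) * s powr (- 1 / r))\<^sup>2)))"
proof -
  have "exp (of_real x / of_real r) = (of_real (exp (x / r)) :: complex)"
    by (simp add: exp_of_real[symmetric])
  then show ?thesis
    unfolding F_integrand_def zeta_def
    by (simp only: of_real_mult of_real_divide of_real_add of_real_power of_real_1)
qed

lemma F_of_real: "F (of_real x) = of_real (Fr x)"
  unfolding F_def Fr_def F_integrand_of_real by (rule integral_complex_of_real)

text \<open>For positive \<open>\<zeta>\<close> the kernel is at most \<open>\<zeta>\<close>, used for \<open>s \<ge> t\<close>, and at most \<open>1 / \<zeta>\<close>, used for
  \<open>s < t\<close>. The two parts give \<open>kappa t / r\<close> and \<open>\<omega> t\<close>, and the latter is again controlled by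
  \<open>kappa t\<close>.\<close>

lemma Fr_le: "Fr x \<le> upper_const * kappa (exp x)"
proof -
  define t where "t = exp x"
  have t: "t > 0" by (simp add: t_def)
  have et: "exp (x / r) = t powr (1 / r)" by (simp add: t_def exp_powr_real)
  define G where "G s = (s powr (1 / r - 1) * indicator {1..t} s)" for s :: real
  have G: "integrable lborel G" "(\<integral>s. G s \<partial>lborel) \<le> r * t powr (1 / r)"
  proof -
    have "has_bochner_integral lborel G (r * t powr (1 / r) - r * 1 powr (1 / r))" if "1 \<le> t"
      unfolding G_def
    proof (rule has_bochner_integral_FTC_Icc_real[OF that])
      fix s :: real assume "1 \<le> s"
      then show "((\<lambda>s. r * s powr (1 / r)) has_real_derivative s powr (1 / r - 1)) (at s)"
        using r by (auto intro!: derivative_eq_intros)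
      show "isCont (\<lambda>s. s powr (1 / r - 1)) s"
        using \<open>1 \<le> s\<close> by (intro continuous_intros) auto
    qed
    moreover have "has_bochner_integral lborel G 0" if "\<not> 1 \<le> t"
    proof -
      have "G = (\<lambda>s. 0)" using that by (auto simp: G_def)
      then show ?thesis by (simp add: has_bochner_integral_zero)
    qed
    ultimately show "integrable lborel G" "(\<integral>s. G s \<partial>lborel) \<le> r * t powr (1 / r)"
      using r by (cases "1 \<le> t"; auto simp: has_bochner_integral_iff)+
  qed
  have pw: "j s * (exp (x / r) / (r * (1 + exp (x / r) * s powr (- 1 / r))\<^sup>2))
      \<le> t powr (1 / r) / r * (indicator {t..} s * j s) + \<omega> t * t powr (- 1 / r) / r * G s" (is "?lhs \<le> _") for s
  proof (cases "s \<ge> t")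
    case True
    have "1 + exp (x / r) * s powr (- 1 / r) \<ge> 1" by simp
    then have *: "1 \<le> (1 + exp (x / r) * s powr (- 1 / r))\<^sup>2" by (rule one_le_power)
    then have "0 < (1 + exp (x / r) * s powr (- 1 / r))\<^sup>2" by linarith
    then have "exp (x / r) / (r * (1 + exp (x / r) * s powr (- 1 / r))\<^sup>2) \<le> exp (x / r) / r"
      using r * by (intro divide_left_mono mult_pos_pos) auto
    then have "?lhs \<le> j s * (exp (x / r) / r)"
      by (intro mult_left_mono j_nonneg)
    moreover have "0 \<le> \<omega> t * t powr (- 1 / r) / r * G s"
      using r omega_nonneg by (simp add: G_def)
    ultimately show ?thesis using True by (simp add: et mult_ac)
  next
    case False
    show ?thesis
    proof (cases "s \<ge> 1")
      case True
      define q where "q = exp (x / r) * s powr (- 1 / r)"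
      have q: "q > 0" using True by (simp add: q_def)
      have "q\<^sup>2 \<le> (1 + q)\<^sup>2" using q by (intro power_mono) auto
      then have "exp (x / r) / (r * (1 + q)\<^sup>2) \<le> exp (x / r) / (r * q\<^sup>2)"
        using q r by (intro divide_left_mono) (auto intro!: mult_pos_pos)
      then have "?lhs \<le> j s * (exp (x / r) / (r * q\<^sup>2))"
        unfolding q_def by (intro mult_left_mono j_nonneg)
      also have "\<dots> = \<omega> s * (s powr (1 / r - 1) * t powr (- 1 / r) / r)"
      proof -
        have "exp (x / r) / q\<^sup>2 = t powr (- 1 / r) * s powr (2 / r)"
          using t True by (simp add: q_def et power2_eq_square powr_minus field_simps flip: powr_add)
        moreover have "s powr (- 1 - 1 / r) * s powr (2 / r) = s powr (1 / r - 1)"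
          using True by (simp flip: powr_add)
        ultimately have "s powr (- 1 - 1 / r) * (exp (x / r) / q\<^sup>2) = s powr (1 / r - 1) * t powr (- 1 / r)"
          by simp
        moreover have "j s * (exp (x / r) / (r * q\<^sup>2)) = \<omega> s * (s powr (- 1 - 1 / r) * (exp (x / r) / q\<^sup>2)) / r"
          by (simp add: mult_ac)
        ultimately show ?thesis by simp
      qed
      also have "\<dots> \<le> \<omega> t * (s powr (1 / r - 1) * t powr (- 1 / r) / r)"
        using False r by (intro mult_right_mono monoD[OF mono]) auto
      finally show ?thesis using True False by (simp add: G_def mult_ac)
    next
      case False
      then have "\<omega> s = 0" using zero by simp
      then show ?thesis using r omega_nonneg by (simp add: G_def)
    qed
  qed
  have "Fr x \<le> (\<integral>s. t powr (1 / r) / r * (indicator {t..} s * j s) + \<omega> t * t powr (- 1 / r) / r * G s \<partial>lborel)"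
    unfolding Fr_def
  proof (rule integral_mono)
    have "integrable lborel (\<lambda>s. Re (F_integrand (of_real x) s))"
      using F_integrable[of "of_real x"] r by (intro integrable_Re) (simp add: sector_iff)
    moreover have "F_integrand (of_real x) s = of_real (j s * (exp (x / r) / (r * (1 + exp (x / r) * s powr (- 1 / r))\<^sup>2)))" for s
      by (rule F_integrand_of_real)
    ultimately show "integrable lborel (\<lambda>s. j s * (exp (x / r) / (r * (1 + exp (x / r) * s powr (- 1 / r))\<^sup>2)))"
      by (simp only: Re_complex_of_real)
    show "integrable lborel (\<lambda>s. t powr (1 / r) / r * (indicator {t..} s * j s) + \<omega> t * t powr (- 1 / r) / r * G s)"
      by (intro Bochner_Integration.integrable_add Bochner_Integration.integrable_mult_right integrable_tail G)
  qed (rule pw)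
  also have "\<dots> = t powr (1 / r) / r * (\<integral>s. indicator {t..} s * j s \<partial>lborel)
      + \<omega> t * t powr (- 1 / r) / r * (\<integral>s. G s \<partial>lborel)"
    by (subst Bochner_Integration.integral_add)
      (auto intro!: Bochner_Integration.integrable_mult_right integrable_tail G)
  also have "\<dots> \<le> kappa t / r + \<omega> t"
  proof (rule add_mono)
    show "t powr (1 / r) / r * (\<integral>s. indicator {t..} s * j s \<partial>lborel) \<le> kappa t / r"
      using kappa_eq_tail[OF t] by simp
    have "\<omega> t * t powr (- 1 / r) / r * (\<integral>s. G s \<partial>lborel) \<le> \<omega> t * t powr (- 1 / r) / r * (r * t powr (1 / r))"
      using G(2) r omega_nonneg by (intro mult_left_mono) auto
    also have "\<dots> = \<omega> t" using r t by (simp add: powr_minus)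
    finally show "\<omega> t * t powr (- 1 / r) / r * (\<integral>s. G s \<partial>lborel) \<le> \<omega> t" .
  qed
  also have "\<omega> t \<le> kappa t / 2 powr (- 1 - 1 / r)"
    using kappa_ge_omega[of t] t by (simp add: field_simps)
  finally show ?thesis by (simp add: upper_const_def t_def ring_distribs)
qed

end


section \<open>Linearity and continuity\<close>

context laplace_kernel
begin

lemma series_add:
  assumes "q > 0" "\<And>p. norm (b p) \<le> C * q ^ p" "\<And>p. norm (b' p) \<le> C' * q ^ p"
  shows "series q (\<lambda>p. b p + b' p) v = series q b v + series q b' v"
proof (cases "v \<le> - ln (2 * q)")
  case True
  have "(\<Sum>p. b p * exp (of_nat p * of_real v) + b' p * exp (of_nat p * of_real v))
      = (\<Sum>p. b p * exp (of_nat p * of_real v)) + (\<Sum>p. b' p * exp (of_nat p * of_real v))"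
    using power_series_bound(1)[OF assms(1) True assms(2)] power_series_bound(1)[OF assms(1) True assms(3)]
    by (rule suminf_add[symmetric])
  then show ?thesis by (simp add: series_def distrib_right scaleR_add_right)
qed (simp add: series_def)

lemma series_mult:
  assumes "q > 0" "\<And>p. norm (b p) \<le> C * q ^ p"
  shows "series q (\<lambda>p. c * b p) v = c * series q b v"
proof (cases "v \<le> - ln (2 * q)")
  case True
  have "(\<Sum>p. c * (b p * exp (of_nat p * of_real v))) = c * (\<Sum>p. b p * exp (of_nat p * of_real v))"
    using power_series_bound(1)[OF assms(1) True assms(2)] by (rule suminf_mult)
  then show ?thesis by (simp add: series_def mult.assoc)
qed (simp add: series_def)

lemma laplace_add:
  assumes "q > 0" "\<And>p. norm (b p) \<le> C * q ^ p" "\<And>p. norm (b' p) \<le> C' * q ^ p" "w \<in> sector r"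
  shows "laplace q (\<lambda>p. b p + b' p) w = laplace q b w + laplace q b' w"
  using Bochner_Integration.integral_add
    [OF series_integrable[OF assms(1,2,4)] series_integrable[OF assms(1,3,4)]]
  by (simp add: laplace_def series_add[OF assms(1-3)] distrib_left)

lemma laplace_mult:
  assumes "q > 0" "\<And>p. norm (b p) \<le> C * q ^ p"
  shows "laplace q (\<lambda>p. c * b p) w = c * laplace q b w"
  by (simp add: laplace_def series_mult[OF assms] mult.left_commute)

end

lemma seq_space_iff:
  assumes "\<And>p. M p > 0" "h > 0"
  shows "a \<in> seq_space M h \<longleftrightarrow> (\<exists>C. \<forall>p. norm (a p) \<le> C * (h ^ p * M p))"
proof -
  have "0 < h ^ p * M p" for p using assms by simp
  then show ?thesis
    by (auto simp: seq_space_def seq_ratios_def bdd_above_def pos_divide_le_eq)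
qed

lemma seq_norm_bound:
  assumes "\<And>p. M p > 0" "h > 0" "a \<in> seq_space M h"
  shows "norm (a p) \<le> seq_norm M h a * (h ^ p * M p)"
proof -
  have "norm (a p) / (h ^ p * M p) \<le> seq_norm M h a"
    using assms(3) unfolding seq_norm_def seq_space_def seq_ratios_def
    by (intro cSUP_upper) auto
  moreover have "0 < h ^ p * M p" using assms by simp
  ultimately show ?thesis by (simp add: pos_divide_le_eq)
qed

lemma seq_space_add_mult:
  assumes "\<And>p. M p > 0" "h > 0" "a \<in> seq_space M h" "b \<in> seq_space M h"
  shows "(\<lambda>p. a p + c * b p) \<in> seq_space M h"
proof -
  have "norm (a p + c * b p) \<le> (seq_norm M h a + norm c * seq_norm M h b) * (h ^ p * M p)" for p
  proof -
    have "norm (a p + c * b p) \<le> norm (a p) + norm c * norm (b p)"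
      by (metis norm_mult norm_triangle_ineq)
    also have "\<dots> \<le> seq_norm M h a * (h ^ p * M p) + norm c * (seq_norm M h b * (h ^ p * M p))"
      using seq_norm_bound assms by (intro add_mono mult_left_mono) auto
    finally show ?thesis by (simp add: ring_distribs)
  qed
  then show ?thesis using assms(1,2) by (auto simp: seq_space_iff)
qed

lemma bounded_operator_linear_continuous:
  assumes M: "\<And>p. M p > 0" and h: "h > 0" and S: "S \<noteq> {}"
    and add: "\<And>a b. a \<in> seq_space M h \<Longrightarrow> b \<in> seq_space M h \<Longrightarrow> E (\<lambda>p. a p + b p) = (\<lambda>z. E a z + E b z)"
    and mult: "\<And>a c. a \<in> seq_space M h \<Longrightarrow> E (\<lambda>p. c * a p) = (\<lambda>z. c * E a z)"
    and holo: "\<And>a. a \<in> seq_space M h \<Longrightarrow> E a holomorphic_on S"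
    and zero: "\<And>a z. a \<in> seq_space M h \<Longrightarrow> z \<notin> S \<Longrightarrow> E a z = 0"
    and C: "C \<ge> 0"
    and bound: "\<And>a z p. a \<in> seq_space M h \<Longrightarrow> z \<in> S \<Longrightarrow>
        norm (nth_deriv p (E a) z) / (h' ^ p * M' p) \<le> C * seq_norm M h a"
  shows "linear_between (seq_space M h) (fun_space M' h' S) E \<and>
    continuous_between (seq_space M h) (seq_norm M h) (fun_norm M' h' S) E"
proof
  have "E a \<in> fun_space M' h' S" if "a \<in> seq_space M h" for a
    using that holo zero bound unfolding fun_space_def fun_ratios_def bdd_above_def by blast
  then show "linear_between (seq_space M h) (fun_space M' h' S) E"
    using add mult by (auto simp: linear_between_def)
  show "continuous_between (seq_space M h) (seq_norm M h) (fun_norm M' h' S) E"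
    unfolding continuous_between_def
  proof (intro ballI allI impI)
    fix a and e :: real assume a: "a \<in> seq_space M h" and e: "e > 0"
    show "\<exists>d>0. \<forall>b\<in>seq_space M h. seq_norm M h (\<lambda>i. b i - a i) < d \<longrightarrow>
        fun_norm M' h' S (\<lambda>z. E b z - E a z) < e"
    proof (intro exI[of _ "e / (C + 1)"] conjI ballI impI)
      fix b assume b: "b \<in> seq_space M h" and small: "seq_norm M h (\<lambda>i. b i - a i) < e / (C + 1)"
      have d: "(\<lambda>i. b i - a i) \<in> seq_space M h"
        using seq_space_add_mult[OF M h b a, of "-1"] by simp
      have na: "(\<lambda>i. - a i) \<in> seq_space M h"
        using seq_space_add_mult[OF M h a a, of "-2"] by simp
      have "E (\<lambda>i. b i - a i) = (\<lambda>z. E b z - E a z)"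
        using add[OF b na] mult[OF a, of "-1"] by simp
      then have "fun_norm M' h' S (\<lambda>z. E b z - E a z) = fun_norm M' h' S (E (\<lambda>i. b i - a i))" by simp
      also have "\<dots> \<le> C * seq_norm M h (\<lambda>i. b i - a i)"
        unfolding fun_norm_def
      proof (rule cSup_least)
        show "fun_ratios M' h' S (E (\<lambda>i. b i - a i)) \<noteq> {}"
          using S by (auto simp: fun_ratios_def)
      qed (use bound[OF d] in \<open>auto simp: fun_ratios_def\<close>)
      also have "\<dots> \<le> C * (e / (C + 1))" using small C by (intro mult_left_mono) auto
      also have "\<dots> < e" using C e by (simp add: field_simps)
      finally show "fun_norm M' h' S (\<lambda>z. E b z - E a z) < e" .
    qed (use e C in auto)
  qed
qed

lemma weight_matrix_pos: "0 < weight_matrix \<tau> l p"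
  by (simp add: weight_matrix_def)

section \<open>The kernel attached to a weight function\<close>

context gamma_weight
begin

text \<open>A quantitative form of \<open>log t = o(\<omega> t)\<close> that is uniform on the whole line.\<close>

lemma omega_dominates:
  assumes "m > 0"
  obtains C where "C \<ge> 0" "\<And>v. m * v \<le> \<omega> (exp v) + C"
proof -
  have "eventually (\<lambda>t. norm (ln t) \<le> 1 / m * norm (\<omega> t)) at_top"
    using landau_o.smallD[OF ln_small, of "1 / m"] assms by simp
  then obtain T0 where T0: "\<And>t. t \<ge> T0 \<Longrightarrow> norm (ln t) \<le> 1 / m * norm (\<omega> t)"
    by (auto simp: eventually_at_top_linorder)
  define T where "T = max T0 1"
  show ?thesis
  proof (rule that[of "m * ln T"])
    show "0 \<le> m * ln T" using assms by (simp add: T_def)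
    fix v
    show "m * v \<le> \<omega> (exp v) + m * ln T"
    proof (cases "v \<le> ln T")
      case True
      then have "m * v \<le> m * ln T" using assms by (intro mult_left_mono) auto
      then show ?thesis using omega_nonneg[of "exp v"] by linarith
    next
      case False
      then have "exp v \<ge> T" by (metis T_def exp_ge_zero exp_le_cancel_iff exp_ln linorder_le_cases max.strict_coboundedI2 zero_less_one)
      then have "\<bar>v\<bar> \<le> 1 / m * \<omega> (exp v)"
        using T0[of "exp v"] omega_nonneg by (simp add: T_def)
      then have "v \<le> 1 / m * \<omega> (exp v)" by linarith
      then have "m * v \<le> \<omega> (exp v)" using assms by (simp add: field_simps)
      moreover have "0 \<le> m * ln T" using assms by (simp add: T_def)
      ultimately show ?thesis by linarith
    qed
  qed
qed

lemma kernel_majorant_decay: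
  assumes "l > 0"
  shows "\<exists>D. \<forall>v. exp (real n * v) * (exp v * exp (- \<omega> (exp v) / l)) \<le> D * exp (- \<bar>v\<bar>)"
proof -
  have "l * (n + 2) > 0" using assms by simp
  then obtain C where C: "C \<ge> 0" "\<And>v. l * (n + 2) * v \<le> \<omega> (exp v) + C"
    by (rule omega_dominates) blast
  show ?thesis
  proof (intro exI allI)
    fix v :: real
    have "real n * v + v - \<omega> (exp v) / l \<le> C / l - \<bar>v\<bar>"
    proof (cases "v \<ge> 0")
      case True
      have "l * (n + 2) * v / l \<le> (\<omega> (exp v) + C) / l"
        using C(2)[of v] assms by (intro divide_right_mono) auto
      then have "(n + 2) * v \<le> \<omega> (exp v) / l + C / l"
        using assms by (simp add: add_divide_distrib)
      then show ?thesis using True by (simp add: algebra_simps)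
    next
      case False
      have "real n * v \<le> 0" using False by (simp add: mult_nonneg_nonpos)
      moreover have "0 \<le> \<omega> (exp v) / l" "0 \<le> C / l" using omega_nonneg C assms by auto
      ultimately show ?thesis using False by linarith
    qed
    then have "exp (real n * v + v - \<omega> (exp v) / l) \<le> exp (C / l - \<bar>v\<bar>)" by simp
    then show "exp (real n * v) * (exp v * exp (- \<omega> (exp v) / l)) \<le> exp (C / l) * exp (- \<bar>v\<bar>)"
      by (simp flip: exp_add)
  qed
qed

lemma weight_matrix_ge:
  assumes l: "l > 0"
  shows "exp (real N * v) * exp (- \<omega> (exp v) / l) \<le> weight_matrix \<omega> l N"
proof -
  have "l * N + 1 > 0" using l by (intro add_nonneg_pos) auto
  then obtain C where C: "\<And>v. (l * N + 1) * v \<le> \<omega> (exp v) + C"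
    by (rule omega_dominates) blast
  have bdd: "bdd_above ((\<lambda>y. l * real N * y - \<omega> (exp y)) ` {0..})"
  proof (rule bdd_aboveI2)
    fix y :: real assume "y \<in> {0..}"
    then show "l * real N * y - \<omega> (exp y) \<le> C" using C[of y] by (auto simp: algebra_simps)
  qed
  have upper: "l * real N * y - \<omega> (exp y) \<le> young_conj (\<lambda>t. \<omega> (exp t)) (l * real N)" if "y \<ge> 0" for y
    unfolding young_conj_def using that by (intro cSUP_upper[OF _ bdd]) auto
  have le: "l * real N * v - \<omega> (exp v) \<le> young_conj (\<lambda>t. \<omega> (exp t)) (l * real N)"
  proof (cases "v \<ge> 0")
    case True
    then show ?thesis by (rule upper)
  next
    case False
    then have "l * real N * v \<le> 0" using l by (simp add: mult_nonneg_nonpos)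
    then show ?thesis using upper[of 0] zero[of "exp v"] zero[of 1] False by simp
  qed
  have "real N * v + - \<omega> (exp v) / l = 1 / l * (l * real N * v - \<omega> (exp v))"
    using l by (simp add: field_simps)
  also have "\<dots> \<le> 1 / l * young_conj (\<lambda>t. \<omega> (exp t)) (l * real N)"
    using le l by (intro mult_left_mono) auto
  finally show ?thesis unfolding weight_matrix_def by (simp flip: exp_add)
qed

text \<open>The minimal weight: a multiple of \<open>kappa\<close>, made to vanish on \<open>[0, 1]\<close>. The factor is what makes
  the index \<open>x\<close> on the side of \<open>sigma\<close> correspond to the index \<open>8 * x\<close> on the side of \<open>\<omega>\<close>.\<close>

definition scale :: real where
  "scale = upper_const / (4 * lower_const)"

definition sigma :: "real \<Rightarrow> real" where
  "sigma t = scale * max 0 (kappa t - kappa 1)"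

lemma scale_pos: "0 < scale"
  using lower_const_pos upper_const_pos by (simp add: scale_def)

lemma kappa_le_sigma: "kappa t \<le> sigma t / scale + kappa 1"
  using scale_pos by (simp add: sigma_def)

lemma sigma_le_kappa: "sigma t \<le> scale * kappa t"
  unfolding sigma_def using scale_pos kappa_nonneg[of t] kappa_nonneg[of 1]
  by (intro mult_left_mono) auto

lemma sigma_nonneg: "0 \<le> sigma t"
  using scale_pos by (simp add: sigma_def)

text \<open>In the variable \<open>z\<close> the kernel is \<open>z * exp (- F / y)\<close> with \<open>y = 4 * lower_const * x\<close>. The factor
  \<open>z\<close> makes the moment of order 0 converge at the vertex.\<close>

definition K :: "real \<Rightarrow> complex \<Rightarrow> complex" where
  "K x w = exp w * exp (- F w / of_real (4 * lower_const * x))"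

definition majorant :: "real \<Rightarrow> real \<Rightarrow> real" where
  "majorant x v = exp v * exp (- \<omega> (exp v) / (4 * x))"

lemma laplace_kernel_K:
  assumes x: "x > 0"
  shows "laplace_kernel (K x) (majorant x) r"
proof
  show "K x holomorphic_on sector r"
    unfolding K_def using lower_const_pos x by (intro holomorphic_intros F_holomorphic) auto
  show "majorant x \<in> borel_measurable borel"
    unfolding majorant_def by measurable
  show "norm (K x w) \<le> majorant x (Re w)" if "w \<in> sector r" for w
  proof -
    have "\<omega> (exp (Re w)) / (4 * x) = lower_const * \<omega> (exp (Re w)) / (4 * lower_const * x)"
      using lower_const_pos by simp
    also have "\<dots> \<le> Re (F w) / (4 * lower_const * x)"
      using Re_F_ge[OF that] lower_const_pos x by (intro divide_right_mono) auto
    finally have "- Re (F w) / (4 * lower_const * x) \<le> - \<omega> (exp (Re w)) / (4 * x)" by simp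
    then have "exp (Re w) * exp (- Re (F w) / (4 * lower_const * x))
        \<le> exp (Re w) * exp (- \<omega> (exp (Re w)) / (4 * x))"
      by (intro mult_left_mono) auto
    moreover have "Re (- F w / of_real (4 * lower_const * x)) = - Re (F w) / (4 * lower_const * x)"
      by (simp only: Re_divide_of_real uminus_complex.sel)
    ultimately show ?thesis
      unfolding K_def majorant_def norm_mult norm_exp_eq_Re by simp
  qed
  show "\<exists>D. \<forall>v. exp (real n * v) * majorant x v \<le> D * exp (- \<bar>v\<bar>)" for n
    unfolding majorant_def using x by (intro kernel_majorant_decay) auto
qed (rule r)

text \<open>Half of the exponent \<open>\<omega> / (4 * x)\<close> of the majorant makes this integral converge; the other half
  produces the sequence of index \<open>8 * x\<close>.\<close>

definition majorant_mass :: "real \<Rightarrow> real" where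
  "majorant_mass x = (\<integral>v. exp v * exp (- \<omega> (exp v) / (8 * x)) \<partial>lborel)"

lemma majorant_moment_le:
  assumes x: "x > 0"
  shows "(\<integral>v. exp (real N * v) * majorant x v \<partial>lborel) \<le> majorant_mass x * weight_matrix \<omega> (8 * x) N"
proof -
  obtain D where D: "\<And>v. exp (real 0 * v) * (exp v * exp (- \<omega> (exp v) / (8 * x))) \<le> D * exp (- \<bar>v\<bar>)"
    using kernel_majorant_decay[of "8 * x" 0] x by auto
  have "integrable lborel (\<lambda>v. exp v * exp (- \<omega> (exp v) / (8 * x)))"
  proof (rule Bochner_Integration.integrable_bound)
    show "integrable lborel (\<lambda>v. D * exp (- \<bar>v\<bar>))" using integrable_exp_neg_abs by simp
    show "AE v in lborel. norm (exp v * exp (- \<omega> (exp v) / (8 * x))) \<le> norm (D * exp (- \<bar>v\<bar>))"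
    proof (rule AE_I2)
      fix v
      have "norm (exp v * exp (- \<omega> (exp v) / (8 * x))) \<le> D * exp (- \<bar>v\<bar>)"
        using D[of v] by (simp add: abs_mult)
      also have "\<dots> \<le> norm (D * exp (- \<bar>v\<bar>))" by simp
      finally show "norm (exp v * exp (- \<omega> (exp v) / (8 * x))) \<le> norm (D * exp (- \<bar>v\<bar>))" .
    qed
  qed measurable
  then have int: "integrable lborel (\<lambda>v. exp v * exp (- \<omega> (exp v) / (8 * x)) * weight_matrix \<omega> (8 * x) N)"
    by simp
  have "(\<integral>v. exp (real N * v) * majorant x v \<partial>lborel)
      \<le> (\<integral>v. exp v * exp (- \<omega> (exp v) / (8 * x)) * weight_matrix \<omega> (8 * x) N \<partial>lborel)"
  proof (rule integral_mono[OF laplace_kernel.g_moment_integrable[OF laplace_kernel_K[OF x]] int])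
    fix v
    have "exp (real N * v) * majorant x v
        = exp v * exp (- \<omega> (exp v) / (8 * x)) * (exp (real N * v) * exp (- \<omega> (exp v) / (8 * x)))"
      by (simp add: majorant_def flip: exp_add)
    also have "\<dots> \<le> exp v * exp (- \<omega> (exp v) / (8 * x)) * weight_matrix \<omega> (8 * x) N"
      using x by (intro mult_left_mono weight_matrix_ge) auto
    finally show "exp (real N * v) * majorant x v
        \<le> exp v * exp (- \<omega> (exp v) / (8 * x)) * weight_matrix \<omega> (8 * x) N" .
  qed
  then show ?thesis by (simp add: majorant_mass_def)
qed

lemma majorant_mass_nonneg: "0 \<le> majorant_mass x"
  unfolding majorant_mass_def by (intro Bochner_Integration.integral_nonneg) auto

definition moment_const :: "real \<Rightarrow> real" where
  "moment_const x = exp (- 1 - kappa 1 * (scale / x))"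

text \<open>The moments of the kernel dominate the sequence attached to \<open>sigma\<close>, up to the geometric factor
  \<open>exp p\<close>: for each \<open>u \<ge> 0\<close> the integral over \<open>[u - 1, u]\<close> already gives the term of the supremum at
  \<open>exp u\<close>.\<close>

lemma moment_lower_bound:
  assumes x: "x > 0"
  shows "moment_const x * weight_matrix sigma x p \<le> exp 1 ^ p * norm (laplace_kernel.moment (K x) p)"
    and "laplace_kernel.moment (K x) p \<noteq> 0"
proof -
  interpret laplace_kernel "K x" "majorant x" r by (rule laplace_kernel_K[OF x])
  define k where "k v = exp v * exp (- Fr v / (4 * lower_const * x))" for v
  define m where "m = (\<integral>v. k v * exp (real p * v) \<partial>lborel)"
  have Kk: "K x (of_real v) = of_real (k v)" for v
    unfolding K_def k_def F_of_real by (simp flip: exp_of_real)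
  have kint: "K x (of_real v - 0) * exp (of_nat p * of_real v) = of_real (k v * exp (real p * v))" for v
    by (simp add: Kk flip: exp_of_real)
  have "integrable lborel (\<lambda>v. Re (K x (of_real v - 0) * exp (of_nat p * of_real v)))"
    using r by (intro integrable_Re shifted_moment_integrable) (auto simp: sector_iff)
  then have int: "integrable lborel (\<lambda>v. k v * exp (real p * v))"
    unfolding kint by (simp only: Re_complex_of_real)
  have moment: "moment p = of_real m"
    unfolding moment_def m_def using kint by (simp only: diff_zero integral_complex_of_real)
  have lower: "moment_const x * (exp (real p * u) * exp (- sigma (exp u) / x)) \<le> exp (real p) * m" if "u \<ge> 0" for u
  proof -
    let ?c = "exp (u - 1) * exp (- upper_const * kappa (exp u) / (4 * lower_const * x)) * exp (real p * (u - 1))"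
    have pw: "indicator {u - 1..u} v * ?c \<le> k v * exp (real p * v)" for v
    proof (cases "v \<in> {u - 1..u}")
      case True
      have "Fr v \<le> upper_const * kappa (exp v)" by (rule Fr_le)
      also have "\<dots> \<le> upper_const * kappa (exp u)"
        using True upper_const_pos by (intro mult_left_mono kappa_mono) auto
      finally have "- upper_const * kappa (exp u) / (4 * lower_const * x) \<le> - Fr v / (4 * lower_const * x)"
        using lower_const_pos x by (intro divide_right_mono) auto
      moreover have "real p * (u - 1) \<le> real p * v" using True by (intro mult_left_mono) auto
      ultimately have "?c \<le> k v * exp (real p * v)"
        unfolding k_def using True by (intro mult_mono) auto
      then show ?thesis using True by simp
    qed (simp add: k_def)
    have "?c = (\<integral>v. indicator {u - 1..u} v * ?c \<partial>lborel)" by simp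
    also have "\<dots> \<le> m" unfolding m_def by (intro integral_mono int pw) simp
    finally have c: "?c \<le> m" .
    have "kappa (exp u) * scale \<le> (sigma (exp u) / scale + kappa 1) * scale"
      using kappa_le_sigma scale_pos by (intro mult_right_mono) auto
    also have "\<dots> = sigma (exp u) + kappa 1 * scale" using scale_pos by (simp add: field_simps)
    finally have "kappa (exp u) * scale / x \<le> (sigma (exp u) + kappa 1 * scale) / x"
      using x by (intro divide_right_mono) auto
    then have "- sigma (exp u) / x - kappa 1 * (scale / x) \<le> - (kappa (exp u) * scale / x)"
      by (simp add: add_divide_distrib)
    also have "\<dots> = - upper_const * kappa (exp u) / (4 * lower_const * x)"
      by (simp add: scale_def)
    finally have "- 1 - kappa 1 * (scale / x) + (real p * u + - sigma (exp u) / x)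
        \<le> real p + (u - 1 + - upper_const * kappa (exp u) / (4 * lower_const * x) + real p * (u - 1))"
      using that by (simp add: algebra_simps)
    then have "moment_const x * (exp (real p * u) * exp (- sigma (exp u) / x)) \<le> exp (real p) * ?c"
      unfolding moment_const_def exp_add[symmetric] by simp
    also have "\<dots> \<le> exp (real p) * m" using c by (intro mult_left_mono) auto
    finally show ?thesis .
  qed
  have mc: "moment_const x > 0" by (simp add: moment_const_def)
  have "0 < moment_const x * (exp (real p * 0) * exp (- sigma (exp 0) / x))"
    by (simp add: moment_const_def)
  also have "\<dots> \<le> exp (real p) * m" by (rule lower) simp
  finally have m: "m > 0" by (simp add: zero_less_mult_iff)
  show "moment p \<noteq> 0" using m by (simp add: moment)
  define Q where "Q = exp (real p) * m / moment_const x"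
  have Q: "Q > 0" using m mc by (simp add: Q_def)
  have "young_conj (\<lambda>t. sigma (exp t)) (x * real p) \<le> x * ln Q"
    unfolding young_conj_def
  proof (rule cSUP_least)
    fix u :: real assume "u \<in> {0..}"
    then have "exp (real p * u) * exp (- sigma (exp u) / x) \<le> Q"
      using lower[of u] mc by (simp add: Q_def pos_le_divide_eq mult.commute)
    then have "exp (real p * u + - sigma (exp u) / x) \<le> exp (ln Q)" using Q by (simp only: exp_add exp_ln)
    then have "real p * u + - sigma (exp u) / x \<le> ln Q" by simp
    then have "x * (real p * u + - sigma (exp u) / x) \<le> x * ln Q" using x by (intro mult_left_mono) auto
    then show "x * real p * u - sigma (exp u) \<le> x * ln Q" using x by (simp add: algebra_simps)
  qed simp
  then have "1 / x * young_conj (\<lambda>t. sigma (exp t)) (x * real p) \<le> 1 / x * (x * ln Q)"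
    using x by (intro mult_left_mono) auto
  then have "weight_matrix sigma x p \<le> exp (ln Q)"
    unfolding weight_matrix_def using x by simp
  then have "weight_matrix sigma x p \<le> Q" using Q by simp
  then have "moment_const x * weight_matrix sigma x p \<le> exp (real p) * m"
    using mc by (simp add: Q_def pos_le_divide_eq mult.commute)
  then show "moment_const x * weight_matrix sigma x p \<le> exp 1 ^ p * norm (moment p)"
    using m by (simp add: moment flip: exp_of_nat_mult)
qed

section \<open>The extension operator\<close>

text \<open>Division by \<open>p!\<close> passes from derivatives to Taylor coefficients, division by the moment is the
  formal Borel transform that the Laplace transform undoes.\<close>

definition extension :: "real \<Rightarrow> real \<Rightarrow> real \<Rightarrow> (nat \<Rightarrow> complex) \<Rightarrow> complex \<Rightarrow> complex" where
  "extension \<gamma> x h a w = (if w \<in> sector \<gamma>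
     then laplace_kernel.laplace (K x) (exp 1 * h)
       (\<lambda>p. a p / (fact p * laplace_kernel.moment (K x) p)) w
     else 0)"

lemma extension_operator:
  assumes \<gamma>: "0 < \<gamma>" "\<gamma> < r"
  shows "\<exists>k\<^sub>0>0. \<forall>x>0. \<forall>h>0.
          linear_between
            (seq_space (hat (weight_matrix sigma x)) h)
            (fun_space (hat (weight_matrix \<omega> (8 * x))) (k\<^sub>0 * h) (sector \<gamma>)) (extension \<gamma> x h) \<and>
          continuous_between
            (seq_space (hat (weight_matrix sigma x)) h)
            (seq_norm (hat (weight_matrix sigma x)) h)
            (fun_norm (hat (weight_matrix \<omega> (8 * x))) (k\<^sub>0 * h) (sector \<gamma>)) (extension \<gamma> x h) \<and>
          (\<forall>a\<in>seq_space (hat (weight_matrix sigma x)) h. borel_map (sector \<gamma>) (extension \<gamma> x h a) = a)"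
proof -
  obtain \<epsilon> :: real where eps: "0 < \<epsilon>" "\<epsilon> < 1"
      "\<And>w \<xi> :: complex. w \<in> sector \<gamma> \<Longrightarrow> \<xi> \<in> ball 1 \<epsilon> \<Longrightarrow> w + Ln \<xi> \<in> sector r"
    using sector_margin[OF \<gamma>(2)] by blast
  \<comment> \<open>Here \<open>exp 1\<close> comes from the moments, a factor 2 from the cut-off of the series and \<open>4 / \<epsilon>\<close> from
    Cauchy's estimate.\<close>
  define k\<^sub>0 where "k\<^sub>0 = 8 * exp 1 / \<epsilon>"
  have "k\<^sub>0 > 0" using eps by (simp add: k\<^sub>0_def)
  moreover have "linear_between
            (seq_space (hat (weight_matrix sigma x)) h)
            (fun_space (hat (weight_matrix \<omega> (8 * x))) (k\<^sub>0 * h) (sector \<gamma>)) (extension \<gamma> x h) \<and>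
          continuous_between
            (seq_space (hat (weight_matrix sigma x)) h)
            (seq_norm (hat (weight_matrix sigma x)) h)
            (fun_norm (hat (weight_matrix \<omega> (8 * x))) (k\<^sub>0 * h) (sector \<gamma>)) (extension \<gamma> x h) \<and>
          (\<forall>a\<in>seq_space (hat (weight_matrix sigma x)) h. borel_map (sector \<gamma>) (extension \<gamma> x h a) = a)"
    if x: "x > 0" and h: "h > 0" for x h
  proof -
    interpret laplace_kernel "K x" "majorant x" r by (rule laplace_kernel_K[OF x])
    let ?M = "hat (weight_matrix sigma x)" and ?W = "weight_matrix \<omega> (8 * x)"
    define q where "q = exp 1 * h"
    define b where "b a p = a p / (fact p * moment p)" for a :: "nat \<Rightarrow> complex" and p
    define n where "n a = seq_norm ?M h a / moment_const x" for a
    have q: "q > 0" using h by (simp add: q_def)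
    have mc: "moment_const x > 0" by (simp add: moment_const_def)
    have M: "?M p > 0" for p by (simp add: hat_def weight_matrix_pos)
    have ext: "extension \<gamma> x h a w = (if w \<in> sector \<gamma> then laplace q (b a) w else 0)" for a w
      by (simp add: extension_def q_def b_def[abs_def])
    have sub: "w \<in> sector r" if "w \<in> sector \<gamma>" for w
    proof -
      have "\<gamma> * pi / 2 < r * pi / 2" using \<gamma> by simp
      then show ?thesis using that unfolding sector_iff by linarith
    qed
    have b: "norm (b a p) \<le> n a * q ^ p" if a: "a \<in> seq_space ?M h" for a p
    proof -
      have n0: "0 \<le> seq_norm ?M h a"
        using order_trans[OF norm_ge_zero seq_norm_bound[OF M h a, of 0]] M[of 0]
        by (simp add: zero_le_mult_iff)
      have mp: "norm (moment p) > 0" using moment_lower_bound(2)[OF x] by simp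
      have "norm (a p) \<le> seq_norm ?M h a * (h ^ p * (fact p * weight_matrix sigma x p))"
        using seq_norm_bound[OF M h a, of p] by (simp add: hat_def)
      also have "weight_matrix sigma x p \<le> exp 1 ^ p * norm (moment p) / moment_const x"
        using moment_lower_bound(1)[OF x, of p] mc by (simp add: pos_le_divide_eq mult.commute)
      finally have "norm (a p) \<le> seq_norm ?M h a * (h ^ p * (fact p * (exp 1 ^ p * norm (moment p) / moment_const x)))"
        using n0 h by (simp add: mult_left_mono)
      also have "\<dots> = n a * q ^ p * (fact p * norm (moment p))"
        by (simp add: n_def q_def power_mult_distrib mult_ac)
      finally show ?thesis
        using mp by (simp add: b_def norm_divide norm_mult pos_divide_le_eq)
    qed
    define C where "C = 2 / moment_const x * majorant_mass x"
    have C: "C \<ge> 0" using mc majorant_mass_nonneg[of x] by (simp add: C_def)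
    \<comment> \<open>The remainder of order \<open>N\<close> is at most \<open>B a N * \<bar>z\<bar> ^ N\<close>; the opening \<open>\<gamma>\<close> enters only the derivative bounds, through \<open>\<epsilon>\<close>.\<close>
    define B where "B a N = C * seq_norm ?M h a * ((2 * q) ^ N * ?W N)" for a N
    have expansion: "norm (laplace q (b a) w - (\<Sum>j<N. (a j / fact j) * exp (of_nat j * w))) \<le> B a N * exp (real N * Re w)"
      if a: "a \<in> seq_space ?M h" and w: "w \<in> sector r" for a w N
    proof -
      have n0: "0 \<le> n a" using order_trans[OF norm_ge_zero b[OF a, of 0]] by simp
      have "(\<Sum>j<N. (a j / fact j) * exp (of_nat j * w)) = (\<Sum>j<N. b a j * moment j * exp (of_nat j * w))"
        using moment_lower_bound(2)[OF x] by (simp add: b_def)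
      then have "norm (laplace q (b a) w - (\<Sum>j<N. (a j / fact j) * exp (of_nat j * w)))
          \<le> 2 * n a * (2 * q) ^ N * exp (real N * Re w) * (\<integral>v. exp (real N * v) * majorant x v \<partial>lborel)"
        using laplace_expansion[OF q b[OF a] w, of N] by simp
      also have "\<dots> \<le> 2 * n a * (2 * q) ^ N * exp (real N * Re w) * (majorant_mass x * ?W N)"
        using n0 q by (intro mult_left_mono majorant_moment_le[OF x]) auto
      finally show ?thesis by (simp add: B_def C_def n_def mult_ac)
    qed
    have holo: "laplace q (b a) holomorphic_on sector r" if "a \<in> seq_space ?M h" for a
      by (rule laplace_holomorphic[OF q b[OF that]])
    have nth: "nth_deriv p (extension \<gamma> x h a) w = nth_deriv p (laplace q (b a)) w"
      if "w \<in> sector \<gamma>" for a w p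
      by (rule nth_deriv_cong[OF open_sector _ that]) (simp add: ext)
    have bound: "norm (nth_deriv p (extension \<gamma> x h a) w) / ((k\<^sub>0 * h) ^ p * hat ?W p) \<le> C * seq_norm ?M h a"
      if a: "a \<in> seq_space ?M h" and w: "w \<in> sector \<gamma>" for a w p
    proof -
      have "norm (nth_deriv p (extension \<gamma> x h a) w) \<le> fact p * B a p * (4 / \<epsilon>) ^ p"
        unfolding nth[OF w]
        by (rule asymptotic_expansion_derivatives(1)[OF eps holo[OF a] expansion[OF a] w])
      also have "\<dots> = C * seq_norm ?M h a * ((2 * q * (4 / \<epsilon>)) ^ p * hat ?W p)"
        by (simp only: B_def hat_def power_mult_distrib mult_ac)
      also have "2 * q * (4 / \<epsilon>) = k\<^sub>0 * h" by (simp add: k\<^sub>0_def q_def)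
      finally show ?thesis
        using \<open>k\<^sub>0 > 0\<close> h weight_matrix_pos[of \<omega> "8 * x" p]
        by (subst pos_divide_le_eq) (auto simp: hat_def[of ?W])
    qed
    have "borel_map (sector \<gamma>) (extension \<gamma> x h a) = a" if a: "a \<in> seq_space ?M h" for a
    proof (rule borel_map_eq[OF \<gamma>(1)])
      fix w p assume w: "w \<in> sector \<gamma>"
      show "norm (nth_deriv p (extension \<gamma> x h a) w - a p)
          \<le> (fact p * B a (Suc p) * 2 * (4 / \<epsilon>) ^ p) * exp (Re w)"
        unfolding nth[OF w]
        using asymptotic_expansion_derivatives(2)[OF eps holo[OF a] expansion[OF a] w, of p] by simp
    qed
    moreover have
      "linear_between (seq_space ?M h) (fun_space (hat ?W) (k\<^sub>0 * h) (sector \<gamma>)) (extension \<gamma> x h) \<and>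
       continuous_between (seq_space ?M h) (seq_norm ?M h) (fun_norm (hat ?W) (k\<^sub>0 * h) (sector \<gamma>)) (extension \<gamma> x h)"
    proof (rule bounded_operator_linear_continuous[OF M h, where C = C])
      have "0 \<in> sector \<gamma>" using \<gamma> by (simp add: sector_iff)
      then show "sector \<gamma> \<noteq> {}" by auto
    next
      fix a c assume a: "a \<in> seq_space ?M h" and c: "c \<in> seq_space ?M h"
      have "b (\<lambda>p. a p + c p) = (\<lambda>p. b a p + b c p)" by (auto simp: b_def add_divide_distrib)
      then show "extension \<gamma> x h (\<lambda>p. a p + c p) = (\<lambda>z. extension \<gamma> x h a z + extension \<gamma> x h c z)"
        using laplace_add[OF q b[OF a] b[OF c] sub] by (auto simp: ext)
    next
      fix a c assume a: "a \<in> seq_space ?M h"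
      have "b (\<lambda>p. c * a p) = (\<lambda>p. c * b a p)" by (auto simp: b_def)
      then show "extension \<gamma> x h (\<lambda>p. c * a p) = (\<lambda>z. c * extension \<gamma> x h a z)"
        using laplace_mult[OF q b[OF a]] by (auto simp: ext)
    next
      fix a assume a: "a \<in> seq_space ?M h"
      have "laplace q (b a) holomorphic_on sector \<gamma>"
        using holo[OF a] sub by (auto intro: holomorphic_on_subset)
      then show "extension \<gamma> x h a holomorphic_on sector \<gamma>"
        by (rule holomorphic_transform) (simp add: ext)
    qed (use C bound ext in auto)
    ultimately show ?thesis by blast
  qed
  ultimately show ?thesis by blast
qed

end


section \<open>Minimality of the weight\<close>

context gamma_weight
begin

text \<open>The condition says that \<open>kappa\<close> is dominated by \<open>\<tau>\<close> up to constants, which is why the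
  normalization of \<open>kappa\<close> is minimal.\<close>

lemma gamma_cond_iff:
  assumes \<tau>: "\<And>t. t \<ge> 0 \<Longrightarrow> \<tau> t \<ge> 0"
  shows "gamma_cond r \<tau> \<omega> \<longleftrightarrow> (\<exists>C>0. \<forall>t\<ge>0. kappa t \<le> C * \<tau> t + C)"
proof -
  have "(\<integral>\<^sup>+u\<in>{1..}. ennreal (\<omega> (t * u) / u powr (1 + 1 / r)) \<partial>lborel) = ennreal (kappa t)"
    if "t \<ge> 0" for t
  proof -
    have "(\<integral>\<^sup>+u\<in>{1..}. ennreal (\<omega> (t * u) / u powr (1 + 1 / r)) \<partial>lborel)
        = (\<integral>\<^sup>+u. ennreal (kappa_integrand t u) \<partial>lborel)"
    proof (intro nn_integral_cong)
      fix u :: real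
      have "\<omega> (t * u) / u powr (1 + 1 / r) = \<omega> (t * u) * u powr (- 1 - 1 / r)"
        using powr_minus_divide[of u "1 + 1 / r"] by simp
      then show "ennreal (\<omega> (t * u) / u powr (1 + 1 / r)) * indicator {1..} u = ennreal (kappa_integrand t u)"
        by (simp add: kappa_integrand_def indicator_def)
    qed
    also have "\<dots> = ennreal (kappa t)"
      unfolding kappa_def
      by (intro nn_integral_eq_integral kappa_integrable that AE_I2 kappa_integrand_nonneg)
    finally show ?thesis .
  qed
  then have "(\<integral>\<^sup>+u\<in>{1..}. ennreal (\<omega> (t * u) / u powr (1 + 1 / r)) \<partial>lborel) \<le> ennreal (C * \<tau> t + C)
      \<longleftrightarrow> kappa t \<le> C * \<tau> t + C" if "t \<ge> 0" "C > 0" for t C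
    using that \<tau> by (simp add: ennreal_le_iff add_nonneg_nonneg del: ennreal_plus)
  then show ?thesis
    unfolding gamma_cond_def by (intro ex_cong1 conj_cong refl all_cong1 imp_cong)
qed

lemma gamma_cond_sigma: "gamma_cond r sigma \<omega>"
proof (subst gamma_cond_iff[OF sigma_nonneg], intro exI conjI allI impI)
  let ?C = "1 / scale + kappa 1"
  show "0 < ?C" using scale_pos kappa_nonneg[of 1] by (intro add_pos_nonneg) auto
  fix t :: real
  have "kappa t \<le> sigma t / scale + kappa 1" by (rule kappa_le_sigma)
  also have "\<dots> \<le> ?C * sigma t + ?C"
    using scale_pos sigma_nonneg[of t] kappa_nonneg[of 1] by (simp add: field_simps add_nonneg_nonneg)
  finally show "kappa t \<le> ?C * sigma t + ?C" .
qed

lemma sigma_bigo: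
  assumes "weight_function \<tau>" "gamma_cond r \<tau> \<omega>"
  shows "sigma \<in> O[at_top](\<tau>)"
proof -
  have nonneg: "\<tau> t \<ge> 0" if "t \<ge> 0" for t using assms(1) that by (simp add: weight_function_def)
  obtain C where C: "C > 0" "\<And>t. t \<ge> 0 \<Longrightarrow> kappa t \<le> C * \<tau> t + C"
    using assms(2) gamma_cond_iff[of \<tau>] nonneg by blast
  have "eventually (\<lambda>t. \<tau> t \<ge> 1) at_top"
    using assms(1) by (simp add: weight_function_def filterlim_at_top)
  then have "eventually (\<lambda>t. norm (sigma t) \<le> (scale * (2 * C)) * norm (\<tau> t)) at_top"
    using eventually_ge_at_top[of 0]
  proof eventually_elim
    fix t :: real assume t: "1 \<le> \<tau> t" "0 \<le> t"
    have "sigma t \<le> scale * kappa t" by (rule sigma_le_kappa)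
    also have "kappa t \<le> C * \<tau> t + C * 1" using C(2)[OF t(2)] by simp
    also have "C * \<tau> t + C * 1 \<le> C * \<tau> t + C * \<tau> t"
      using t C by (intro add_mono mult_left_mono) auto
    finally show "norm (sigma t) \<le> (scale * (2 * C)) * norm (\<tau> t)"
      using t scale_pos sigma_nonneg[of t] by (simp add: mult_left_mono algebra_simps)
  qed
  then show ?thesis by (rule bigoI)
qed

lemma omega_filterlim: "filterlim \<omega> at_top at_top \<Longrightarrow> filterlim sigma at_top at_top"
proof -
  assume lim: "filterlim \<omega> at_top at_top"
  let ?c = "2 powr (- 1 - 1 / r)"
  have lim': "filterlim (\<lambda>t. scale * (?c * \<omega> t - kappa 1)) at_top at_top"
    using scale_pos lim unfolding diff_conv_add_uminus add.commute[of _ "- kappa 1"]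
    by (intro filterlim_tendsto_pos_mult_at_top[OF tendsto_const]
        filterlim_tendsto_add_at_top[OF tendsto_const]) auto
  show ?thesis
  proof (rule filterlim_at_top_mono[OF lim'])
    show "eventually (\<lambda>t. scale * (?c * \<omega> t - kappa 1) \<le> sigma t) at_top"
      using eventually_ge_at_top[of 0]
    proof eventually_elim
      case (elim t)
      then show ?case
        unfolding sigma_def using kappa_ge_omega[of t] scale_pos by (intro mult_left_mono) auto
    qed
  qed
qed

lemma weight_function_sigma:
  assumes "filterlim \<omega> at_top at_top"
  shows "weight_function sigma"
  unfolding weight_function_def
proof (intro conjI)
  show "continuous_on {0..} sigma"
    unfolding sigma_def by (intro continuous_intros kappa_continuous)
  show "mono_on {0..} sigma"
    unfolding sigma_def using scale_pos
    by (intro mono_onI mult_left_mono max.mono diff_right_mono kappa_mono) auto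
  show "sigma 0 = 0" using kappa_mono[of 0 1] by (simp add: sigma_def)
qed (use assms omega_filterlim sigma_nonneg in auto)

lemma normalized_sigma: "normalized sigma"
  using kappa_mono[of _ 1] by (auto simp: normalized_def sigma_def)

lemma omega_bigo_sigma:
  assumes "filterlim \<omega> at_top at_top"
  shows "\<omega> \<in> O[at_top](sigma)"
proof -
  let ?c = "2 powr (- 1 - 1 / r)"
  have "eventually (\<lambda>t. sigma t \<ge> 1) at_top"
    using omega_filterlim[OF assms] by (simp add: filterlim_at_top)
  then have "eventually (\<lambda>t. norm (\<omega> t) \<le> ((1 / scale + kappa 1) / ?c) * norm (sigma t)) at_top"
    using eventually_ge_at_top[of 0]
  proof eventually_elim
    fix t :: real assume t: "1 \<le> sigma t" "0 \<le> t"
    have "?c * \<omega> t \<le> kappa t" by (rule kappa_ge_omega) fact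
    also have "\<dots> \<le> sigma t / scale + kappa 1 * 1" using kappa_le_sigma by simp
    also have "\<dots> \<le> sigma t / scale + kappa 1 * sigma t"
      using t kappa_nonneg[of 1] by (intro add_mono mult_left_mono) auto
    also have "\<dots> = (1 / scale + kappa 1) * sigma t" by (simp add: algebra_simps)
    finally have "\<omega> t \<le> ((1 / scale + kappa 1) * sigma t) / ?c"
      by (simp add: pos_le_divide_eq mult.commute)
    then show "norm (\<omega> t) \<le> ((1 / scale + kappa 1) / ?c) * norm (sigma t)"
      using t omega_nonneg by simp
  qed
  then show ?thesis by (rule bigoI)
qed

end

section \<open>The extension theorem\<close>

text \<open>A weight function is prescribed on \<open>[0, \<infinity>)\<close> only; replacing it by \<open>\<omega> (max 0 t)\<close> changes none
  of the notions involved.\<close>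

lemma weight_matrix_extend: "weight_matrix (\<lambda>t. \<omega> (max 0 t)) = weight_matrix \<omega>"
  by (intro ext) (simp add: weight_matrix_def)

lemma gamma_cond_extend: "gamma_cond r \<tau> (\<lambda>t. \<omega> (max 0 t)) \<longleftrightarrow> gamma_cond r \<tau> \<omega>"
proof -
  have "(\<integral>\<^sup>+u\<in>{1..}. ennreal (\<omega> (max 0 (t * u)) / u powr (1 + 1 / r)) \<partial>lborel)
      = (\<integral>\<^sup>+u\<in>{1..}. ennreal (\<omega> (t * u) / u powr (1 + 1 / r)) \<partial>lborel)" if "t \<ge> 0" for t
    using that by (intro nn_integral_cong) (auto simp: indicator_def max_def zero_le_mult_iff)
  then show ?thesis by (simp add: gamma_cond_def)
qed

lemma eventually_extend: "eventually (\<lambda>t. \<omega> (max 0 t) = \<omega> t) at_top" for \<omega> :: "real \<Rightarrow> real"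
  using eventually_ge_at_top[of 0] by eventually_elim simp

lemma gamma_weight_extend:
  assumes \<omega>: "weight_function \<omega>" "normalized \<omega>" "ln \<in> o[at_top](\<omega>)"
    and r: "0 < r" "ennreal r < mu \<omega>"
  shows "gamma_weight (\<lambda>t. \<omega> (max 0 t)) r"
proof
  let ?\<omega> = "\<lambda>t. \<omega> (max 0 t)"
  have cont: "continuous_on {0..} \<omega>" and mono: "mono_on {0..} \<omega>" and nonneg: "\<And>t. t \<ge> 0 \<Longrightarrow> \<omega> t \<ge> 0"
    using \<omega>(1) by (auto simp: weight_function_def)
  show cont': "continuous_on UNIV ?\<omega>"
    by (rule continuous_on_compose2[OF cont]) (auto intro!: continuous_intros)
  show "mono ?\<omega>"
    by (intro monoI mono_onD[OF mono]) auto
  show zero: "?\<omega> t = 0" if "t \<le> 1" for t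
    using \<omega>(2) that by (auto simp: normalized_def)
  show "ln \<in> o[at_top](?\<omega>)"
    using \<omega>(3) by (subst landau_o.small.cong[OF eventually_extend])
  show "integrable lborel (\<lambda>s. ?\<omega> s * s powr (- 1 - 1 / r))"
  proof -
    obtain r' where r': "r' > 0" "(\<integral>\<^sup>+u\<in>{1..}. ennreal (\<omega> u / u powr (1 + 1 / r')) \<partial>lborel) < \<infinity>" "r < r'"
      using r unfolding mu_def less_SUP_iff by (auto simp: ennreal_less_iff)
    have [measurable]: "?\<omega> \<in> borel_measurable borel"
      by (rule borel_measurable_continuous_onI[OF cont'])
    show ?thesis
    proof (rule integrableI_bounded)
      have "(\<integral>\<^sup>+s. ennreal (norm (?\<omega> s * s powr (- 1 - 1 / r))) \<partial>lborel)
          \<le> (\<integral>\<^sup>+u\<in>{1..}. ennreal (\<omega> u / u powr (1 + 1 / r')) \<partial>lborel)"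
      proof (rule nn_integral_mono)
        fix s :: real
        show "ennreal (norm (?\<omega> s * s powr (- 1 - 1 / r)))
            \<le> ennreal (\<omega> s / s powr (1 + 1 / r')) * indicator {1..} s"
        proof (cases "s \<ge> 1")
          case True
          have "1 / r' \<le> 1 / r" using r r' by (intro divide_left_mono) auto
          then have "s powr (- 1 - 1 / r) \<le> s powr (- 1 - 1 / r')"
            using True by (intro powr_mono) auto
          then have "\<omega> s * s powr (- 1 - 1 / r) \<le> \<omega> s * s powr (- 1 - 1 / r')"
            using nonneg True by (intro mult_left_mono) auto
          also have "\<dots> = \<omega> s / s powr (1 + 1 / r')"
            using powr_minus_divide[of s "1 + 1 / r'"] by simp
          finally show ?thesis
            using True nonneg[of s] by (simp add: abs_mult ennreal_leI)
        qed (use zero[of s] in simp)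
      qed
      also note r'(2)
      finally show "(\<integral>\<^sup>+s. ennreal (norm (?\<omega> s * s powr (- 1 - 1 / r))) \<partial>lborel) < \<infinity>" .
    qed measurable
  qed
qed (rule r)

theorem theorem6p4:
  fixes \<omega> :: "real \<Rightarrow> real" and r :: real
  assumes "weight_function \<omega>" and "normalized \<omega>" and "ln \<in> o[at_top](\<omega>)"
    and "mu \<omega> > 0" and "0 < r" and "ennreal r < mu \<omega>"
  shows "\<exists>\<sigma>. weight_function \<sigma> \<and> normalized \<sigma> \<and> ln \<in> o[at_top](\<sigma>) \<and>
    (\<forall>\<gamma>. 0 < \<gamma> \<and> \<gamma> < r \<longrightarrow>
      (\<exists>k\<^sub>0>0. \<forall>x>0. \<forall>h>0.
        \<exists>E :: (nat \<Rightarrow> complex) \<Rightarrow> complex \<Rightarrow> complex.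
          linear_between
            (seq_space (hat (weight_matrix \<sigma> x)) h)
            (fun_space (hat (weight_matrix \<omega> (8 * x))) (k\<^sub>0 * h) (sector \<gamma>)) E \<and>
          continuous_between
            (seq_space (hat (weight_matrix \<sigma> x)) h)
            (seq_norm (hat (weight_matrix \<sigma> x)) h)
            (fun_norm (hat (weight_matrix \<omega> (8 * x))) (k\<^sub>0 * h) (sector \<gamma>)) E \<and>
          (\<forall>a\<in>seq_space (hat (weight_matrix \<sigma> x)) h. borel_map (sector \<gamma>) (E a) = a)) \<and>
      seq_space_family (\<lambda>x. hat (weight_matrix \<sigma> x))
        \<subseteq> borel_map (sector \<gamma>) ` fun_space_family (\<lambda>x. hat (weight_matrix \<omega> x)) (sector \<gamma>)) \<and>
    \<omega> \<in> O[at_top](\<sigma>) \<and> gamma_cond r \<sigma> \<omega> \<and>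
    (\<forall>\<tau>. weight_function \<tau> \<and> normalized \<tau> \<and> ln \<in> o[at_top](\<tau>) \<and>
         \<omega> \<in> O[at_top](\<tau>) \<and> gamma_cond r \<tau> \<omega> \<longrightarrow> \<sigma> \<in> O[at_top](\<tau>))"
proof -
  let ?\<omega> = "\<lambda>t. \<omega> (max 0 t)"
  interpret gamma_weight ?\<omega> r
    using assms by (intro gamma_weight_extend)
  have lim: "filterlim ?\<omega> at_top at_top"
    using assms(1) filterlim_cong[OF refl refl eventually_extend[of \<omega>], of at_top]
    by (simp add: weight_function_def)
  have big: "\<omega> \<in> O[at_top](sigma)"
    using omega_bigo_sigma[OF lim] by (subst (asm) landau_o.big.in_cong[OF eventually_extend])
  note ops = extension_operator[unfolded weight_matrix_extend]
  show ?thesis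
  proof (intro exI[of _ sigma] conjI allI impI; (elim conjE)?)
    show "ln \<in> o[at_top](sigma)"
      using assms(3) big by (rule landau_o.small_big_trans)
    show "gamma_cond r sigma \<omega>"
      using gamma_cond_sigma by (simp add: gamma_cond_extend)
    show "sigma \<in> O[at_top](\<tau>)" if "weight_function \<tau>" "gamma_cond r \<tau> \<omega>" for \<tau>
      using sigma_bigo[OF that(1)] that(2) by (simp add: gamma_cond_extend)
  next
    fix \<gamma> assume \<gamma>: "0 < \<gamma>" "\<gamma> < r"
    show "\<exists>k\<^sub>0>0. \<forall>x>0. \<forall>h>0.
        \<exists>E :: (nat \<Rightarrow> complex) \<Rightarrow> complex \<Rightarrow> complex.
          linear_between
            (seq_space (hat (weight_matrix sigma x)) h)
            (fun_space (hat (weight_matrix \<omega> (8 * x))) (k\<^sub>0 * h) (sector \<gamma>)) E \<and>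
          continuous_between
            (seq_space (hat (weight_matrix sigma x)) h)
            (seq_norm (hat (weight_matrix sigma x)) h)
            (fun_norm (hat (weight_matrix \<omega> (8 * x))) (k\<^sub>0 * h) (sector \<gamma>)) E \<and>
          (\<forall>a\<in>seq_space (hat (weight_matrix sigma x)) h. borel_map (sector \<gamma>) (E a) = a)"
      using ops[OF \<gamma>] by blast
    show "seq_space_family (\<lambda>x. hat (weight_matrix sigma x))
        \<subseteq> borel_map (sector \<gamma>) ` fun_space_family (\<lambda>x. hat (weight_matrix \<omega> x)) (sector \<gamma>)"
    proof
      fix a assume "a \<in> seq_space_family (\<lambda>x. hat (weight_matrix sigma x))"
      then obtain x h where xh: "x > 0" "h > 0" and a: "a \<in> seq_space (hat (weight_matrix sigma x)) h"
        by (auto simp: seq_space_family_def)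
      obtain k\<^sub>0 where k0: "k\<^sub>0 > 0" and
        lin: "linear_between (seq_space (hat (weight_matrix sigma x)) h)
            (fun_space (hat (weight_matrix \<omega> (8 * x))) (k\<^sub>0 * h) (sector \<gamma>)) (extension \<gamma> x h)"
        and bor: "borel_map (sector \<gamma>) (extension \<gamma> x h a) = a"
        using ops[OF \<gamma>] xh a by blast
      have "extension \<gamma> x h a \<in> fun_space (hat (weight_matrix \<omega> (8 * x))) (k\<^sub>0 * h) (sector \<gamma>)"
        using lin a by (simp add: linear_between_def)
      moreover have "8 * x > 0" "k\<^sub>0 * h > 0" using xh k0 by auto
      ultimately have "extension \<gamma> x h a \<in> fun_space_family (\<lambda>x. hat (weight_matrix \<omega> x)) (sector \<gamma>)"
        unfolding fun_space_family_def by blast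
      then show "a \<in> borel_map (sector \<gamma>) ` fun_space_family (\<lambda>x. hat (weight_matrix \<omega> x)) (sector \<gamma>)"
        using bor by (metis imageI)
    qed
  qed (use big lim in \<open>auto intro: weight_function_sigma normalized_sigma\<close>)
qed

end
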